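(* Let $\beta\in(0,1)$, $0<T<\infty$, $u_0\in\mathbb R$, and let $g\in C(0,T]$ satisfy $|g(x)|\le Mx^{\alpha-\beta}$ for some $M,\alpha>0$ and all $x\in(0,T]$. Then there exists a unique function $u\in C_\beta[0,T]$ satisfying $$\partial_0^\beta u(x)=g(x)\ \text{ for } x\in(0,T],\qquad u(0)=u_0,$$ and it has the series representation $$u(x)-u_0=I_0^\beta g(x):=\sum_{j=0}^\infty \mathcal K^jJ_0^\beta g(x),$$ where $\mathcal K^0$ is the identity. Moreover, $u$ depends continuously on $u_0$ and $g$ in the following sense: there is a constant $C$ depending only on $\alpha,\beta,T$ such that $$\|u-u_0\|_{C[0,T]}\le C\sup_{x\in(0,T]}\big|x^{\beta-\alpha}g(x)\big| ;$$ in particular, if $g\in C[0,T]$, then $\|u-u_0\|_{C[0,T]}\le C\|g\|_{C[0,T]}$ with $C$ depending only on $\beta$ and $T$.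
   Context: Fix $\beta\in(0,1)$ and $0<T<\infty$. $C\cap L^1(0,T]$ is the set of continuous, Lebesgue integrable real functions on $(0,T]$. For $\gamma\in(0,1)$ and $u\in C\cap L^1(0,T]$, the Riemann–Liouville integral is $J_0^\gamma u(x)=\int_0^x\frac{(x-r)^{\gamma-1}}{\Gamma(\gamma)}u(r)\,dr$, $x\in(0,T]$ (for $g$ as in the claim, $J_0^\beta g$ is extended continuously by $J_0^\beta g(0)=0$). Define $C_\beta(0,T]=\{u\in C\cap L^1(0,T]: J_0^{1-\beta}u\in C^1(0,T]\}$ and $C_\beta[0,T]=C[0,T]\cap C_\beta(0,T]$. For $u\in C_\beta(0,T]$, the Riemann–Liouville derivative is $D_0^\beta u=\frac{d}{dx}J_0^{1-\beta}u$, and the censored fractional derivative is $$\partial_0^\beta u(x)=D_0^\beta u(x)-\frac{x^{-\beta}}{\Gamma(1-\beta)}u(x),\quad x\in(0,T].$$ For $\psi\in C[0,T]$, $\mathcal K\psi(x)=\int_0^x\frac{(x-r)^{\beta-1}r^{-\beta}}{\Gamma(\beta)\Gamma(1-\beta)}\psi(r)\,dr$ for $x>0$ and $\mathcal K\psi(0)=\psi(0)$. $\|\cdot\|_{C[0,T]}$ is the sup norm. *)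

theory Defs
  imports "HOL-Analysis.Analysis"
begin

text \<open>
  A function on \<open>(0,T]\<close> or \<open>[0,T]\<close> is represented by a total function \<open>real \<Rightarrow> real\<close>;
  its values outside the interval are irrelevant.
\<close>

definition cont_L1 :: "real \<Rightarrow> (real \<Rightarrow> real) set" where
  "cont_L1 T = {u. continuous_on {0<..T} u \<and> set_integrable lborel {0<..T} u}"

text \<open>
  At \<open>x = 0\<close> the domain of integration is empty, so \<open>RL_integral \<gamma> u 0 = 0\<close>. This is
  the convention used for the continuous extension of \<open>J\<^sub>0\<^sup>\<beta> g\<close> to \<open>[0,T]\<close>.
\<close>

definition RL_integral :: "real \<Rightarrow> (real \<Rightarrow> real) \<Rightarrow> real \<Rightarrow> real" where
  "RL_integral \<gamma> u x = (LINT r:{0<..<x}|lborel. (x - r) powr (\<gamma> - 1) / Gamma \<gamma> * u r)"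

text \<open>
  Derivatives are taken within \<open>(0,T]\<close>: two-sided at interior points, one-sided at \<open>T\<close>.
\<close>

definition C1_half_open :: "real \<Rightarrow> (real \<Rightarrow> real) set" where
  "C1_half_open T = {f. \<exists>f'. (\<forall>x\<in>{0<..T}. (f has_real_derivative f' x) (at x within {0<..T}))
                            \<and> continuous_on {0<..T} f'}"

definition C_beta_half_open :: "real \<Rightarrow> real \<Rightarrow> (real \<Rightarrow> real) set" where
  "C_beta_half_open \<beta> T = {u \<in> cont_L1 T. RL_integral (1 - \<beta>) u \<in> C1_half_open T}"

definition C_beta_closed :: "real \<Rightarrow> real \<Rightarrow> (real \<Rightarrow> real) set" where
  "C_beta_closed \<beta> T = {u. continuous_on {0..T} u} \<inter> C_beta_half_open \<beta> T"

definition RL_deriv :: "real \<Rightarrow> real \<Rightarrow> (real \<Rightarrow> real) \<Rightarrow> real \<Rightarrow> real" where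
  "RL_deriv \<beta> T u x = vector_derivative (RL_integral (1 - \<beta>) u) (at x within {0<..T})"

definition censored_deriv :: "real \<Rightarrow> real \<Rightarrow> (real \<Rightarrow> real) \<Rightarrow> real \<Rightarrow> real" where
  "censored_deriv \<beta> T u x = RL_deriv \<beta> T u x - x powr (- \<beta>) / Gamma (1 - \<beta>) * u x"

definition K_op :: "real \<Rightarrow> (real \<Rightarrow> real) \<Rightarrow> real \<Rightarrow> real" where
  "K_op \<beta> \<psi> x =
     (if x = 0 then \<psi> 0
      else (LINT r:{0<..<x}|lborel.
              (x - r) powr (\<beta> - 1) * r powr (- \<beta>) / (Gamma \<beta> * Gamma (1 - \<beta>)) * \<psi> r))"

definition censored_series_term :: "real \<Rightarrow> (real \<Rightarrow> real) \<Rightarrow> real \<Rightarrow> nat \<Rightarrow> real" where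
  "censored_series_term \<beta> g x j = (K_op \<beta> ^^ j) (RL_integral \<beta> g) x"

definition censored_integral :: "real \<Rightarrow> (real \<Rightarrow> real) \<Rightarrow> real \<Rightarrow> real" where
  "censored_integral \<beta> g x = (\<Sum>j. censored_series_term \<beta> g x j)"

definition censored_ivp_solution ::
    "real \<Rightarrow> real \<Rightarrow> (real \<Rightarrow> real) \<Rightarrow> real \<Rightarrow> (real \<Rightarrow> real) \<Rightarrow> bool" where
  "censored_ivp_solution \<beta> T g u\<^sub>0 u \<longleftrightarrow>
     u \<in> C_beta_closed \<beta> T \<and> (\<forall>x\<in>{0<..T}. censored_deriv \<beta> T u x = g x) \<and> u 0 = u\<^sub>0"

definition admissible_source :: "real \<Rightarrow> real \<Rightarrow> real \<Rightarrow> real \<Rightarrow> (real \<Rightarrow> real) \<Rightarrow> bool" where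
  "admissible_source \<beta> T \<alpha> M g \<longleftrightarrow>
     continuous_on {0<..T} g \<and> (\<forall>x\<in>{0<..T}. \<bar>g x\<bar> \<le> M * x powr (\<alpha> - \<beta>))"

text \<open>Only meaningful for functions bounded on \<open>[0,T]\<close>, in particular for continuous ones.\<close>

definition sup_norm :: "real \<Rightarrow> (real \<Rightarrow> real) \<Rightarrow> real" where
  "sup_norm T f = (SUP x\<in>{0..T}. \<bar>f x\<bar>)"

end

theory Submission
  imports Defs
begin

text \<open>
  With \<open>h = g + r\<^sup>-\<^sup>\<beta> u / \<Gamma>(1 - \<beta>)\<close> the equation \<open>\<partial>u = g\<close> reads \<open>D\<^sup>\<beta> u = h\<close>. Since
  \<open>J\<^sup>\<beta> J\<^sup>1\<^sup>-\<^sup>\<beta> = J\<^sup>1\<^sup>-\<^sup>\<beta> J\<^sup>\<beta> = J\<^sup>1\<close>, it is equivalent, for continuous \<open>u\<close>, to \<open>u = J\<^sup>\<beta> h\<close>, that is to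
  the fixed point equation \<open>u = J\<^sup>\<beta> g + K u\<close>. After the substitution \<open>r = x s\<close> the operator \<open>K\<close>
  averages \<open>\<psi>(x s)\<close> against a fixed probability density on \<open>(0,1)\<close>, so it fixes constants and
  maps \<open>r\<^sup>a\<close> to \<open>c(a) r\<^sup>a\<close> with \<open>c(a) < 1\<close> for \<open>a > 0\<close>. As \<open>\<bar>J\<^sup>\<beta> g\<bar>\<close> is bounded by a multiple of
  \<open>r\<^sup>\<alpha>\<close>, the series \<open>\<Sum>j. K\<^sup>j J\<^sup>\<beta> g\<close> is dominated by a geometric one; this gives existence and the
  stability estimate. A continuous \<open>d = K d\<close> with \<open>d(0) = 0\<close> satisfies \<open>\<bar>d(x)\<bar> \<le> \<epsilon> + A x\<close>, hence
  \<open>\<bar>d(x)\<bar> \<le> \<epsilon> + A c(1)\<^sup>n x\<close> for every \<open>n\<close>, and so vanishes.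
\<close>

section \<open>Integrals over the unit interval\<close>

lemma has_Beta_integral_lborel:
  fixes a b :: real
  assumes "0 < a" "0 < b"
  shows "set_integrable lborel {0<..<1} (\<lambda>t. t powr (a - 1) * (1 - t) powr (b - 1))"
    and "(LINT t:{0<..<1}|lborel. t powr (a - 1) * (1 - t) powr (b - 1)) = Beta a b"
proof -
  have "set_integrable lborel {0..1} (\<lambda>t. t powr (a - 1) * (1 - t) powr (b - 1))"
    using integrable_Beta[OF assms] .
  then show int: "set_integrable lborel {0<..<1} (\<lambda>t. t powr (a - 1) * (1 - t) powr (b - 1))"
    by (rule set_integrable_subset) auto
  have "((\<lambda>t. t powr (a - 1) * (1 - t) powr (b - 1)) has_integral Beta a b) {0<..<1}"
    using has_integral_Beta_real[OF assms] by (simp add: has_integral_Icc_iff_Ioo)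
  then show "(LINT t:{0<..<1}|lborel. t powr (a - 1) * (1 - t) powr (b - 1)) = Beta a b"
    using set_borel_integral_eq_integral(2)[OF int] by (simp add: integral_unique)
qed

text \<open>The substitution t = r + (x - r) s. The general left end serves the kernel on (r, x) in
  the composition rule; left end 0 gives the plain dilation by x.\<close>

lemma
  fixes F :: "real \<Rightarrow> real"
  assumes "r < x"
  shows set_integrable_affine_unit: "set_integrable lborel {r<..<x} F \<longleftrightarrow>
           set_integrable lborel {0<..<1} (\<lambda>s. F (r + (x - r) * s))"
    and set_integral_affine_unit: "(LINT t:{r<..<x}|lborel. F t)
           = (x - r) * (LINT s:{0<..<1}|lborel. F (r + (x - r) * s))"
proof -
  have ind: "indicator {r<..<x} (r + (x - r) * s) = (indicator {0<..<1} s :: real)" for s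
  proof -
    have "r + (x - r) * s < x \<longleftrightarrow> (x - r) * s < (x - r) * 1" by auto
    then have "r + (x - r) * s < x \<longleftrightarrow> s < 1"
      using assms by (subst (asm) mult_less_cancel_left_pos) auto
    then show ?thesis using assms by (auto simp: indicator_def zero_less_mult_iff)
  qed
  show "set_integrable lborel {r<..<x} F \<longleftrightarrow>
           set_integrable lborel {0<..<1} (\<lambda>s. F (r + (x - r) * s))"
    unfolding set_integrable_def
    using assms by (subst lborel_integrable_real_affine_iff[symmetric, of "x - r" _ r]) (auto simp: ind)
  show "(LINT t:{r<..<x}|lborel. F t) = (x - r) * (LINT s:{0<..<1}|lborel. F (r + (x - r) * s))"
    unfolding set_lebesgue_integral_def
    using assms by (subst lborel_integral_real_affine[of "x - r" _ r]) (auto simp: ind)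
qed

section \<open>Weighted means of a dilated function\<close>

text \<open>Common form of J^\<gamma> (up to a power of x) and of K after dilation: x enters only
  through the argument of u, so kernel and domain stay fixed as x varies.\<close>

definition scaled_mean :: "(real \<Rightarrow> real) \<Rightarrow> (real \<Rightarrow> real) \<Rightarrow> real \<Rightarrow> real" where
  "scaled_mean k u x = (LINT s:{0<..<1}|lborel. k s * u (x * s))"

text \<open>With r = x s, the Jacobian x and the factor x^(\<gamma> - 1) of the kernel combine to
  x^\<gamma>.\<close>

lemma RL_integral_eq_scaled_mean:
  assumes "0 < x"
  shows "RL_integral \<gamma> u x = x powr \<gamma> * scaled_mean (\<lambda>s. (1 - s) powr (\<gamma> - 1) / Gamma \<gamma>) u x"
proof -
  have *: "x * ((x - x * s) powr (\<gamma> - 1) / Gamma \<gamma> * u (x * s))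
          = x powr \<gamma> * ((1 - s) powr (\<gamma> - 1) / Gamma \<gamma> * u (x * s))" if "s \<in> {0<..<1}" for s
  proof -
    have "x - x * s = x * (1 - s)" by (simp add: algebra_simps)
    moreover have "x * x powr (\<gamma> - 1) = x powr \<gamma>"
      using assms by (simp add: powr_mult_base)
    ultimately show ?thesis
      using that assms by (simp add: powr_mult mult.assoc[symmetric])
  qed
  show ?thesis
    unfolding RL_integral_def scaled_mean_def set_integral_affine_unit[OF assms]
      set_integral_mult_right[symmetric]
    using * by (intro set_lebesgue_integral_cong) auto
qed

lemma mult_unit_mem_Ioc:
  fixes x s T :: real
  assumes "x \<in> {0<..T}" "s \<in> {0<..<1}"
  shows "x * s \<in> {0<..T}"
  using assms by (auto intro: order_trans[OF mult_left_le])

text \<open>The integrand is dominated by M x^p k(s) s^p; a negative p admits a singularity of u at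
  0. The comparison uses absolute values because no sign of k is assumed.\<close>

lemma scaled_mean_integrable:
  fixes k u :: "real \<Rightarrow> real"
  assumes k: "continuous_on {0<..<1} k" and u: "continuous_on {0<..T} u"
    and bnd: "\<And>r. r \<in> {0<..T} \<Longrightarrow> \<bar>u r\<bar> \<le> M * r powr p"
    and int: "set_integrable lborel {0<..<1} (\<lambda>s. k s * s powr p)"
    and x: "x \<in> {0<..T}"
  shows "set_integrable lborel {0<..<1} (\<lambda>s. k s * u (x * s))"
proof (rule set_integrable_bound)
  have in': "x * s \<in> {0<..T}" if "s \<in> {0<..<1}" for s
    using mult_unit_mem_Ioc[OF x that] .
  show "set_integrable lborel {0<..<1} (\<lambda>s. (M * x powr p) * (k s * s powr p))"
    using int by (rule set_integrable_mult_right)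
  show "set_borel_measurable lborel {0<..<1} (\<lambda>s. k s * u (x * s))"
  proof -
    have "continuous_on {0<..<1} (\<lambda>s. u (x * s))"
      using in' by (intro continuous_on_compose2[OF u]) (auto intro!: continuous_intros)
    then have "set_borel_measurable borel {0<..<1} (\<lambda>s. k s * u (x * s))"
      by (intro set_measurable_continuous_on continuous_intros k) auto
    then show ?thesis by (simp add: set_borel_measurable_def)
  qed
  have "\<bar>k s * u (x * s)\<bar> \<le> \<bar>(M * x powr p) * (k s * s powr p)\<bar>" if "s \<in> {0<..<1}" for s
  proof -
    have "\<bar>u (x * s)\<bar> \<le> M * (x powr p * s powr p)"
      using bnd[OF in'[OF that]] that x by (simp add: powr_mult)
    then have "\<bar>u (x * s)\<bar> \<le> \<bar>M * (x powr p * s powr p)\<bar>" by linarith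
    then have "\<bar>k s\<bar> * \<bar>u (x * s)\<bar> \<le> \<bar>k s\<bar> * \<bar>M * (x powr p * s powr p)\<bar>"
      by (intro mult_left_mono) auto
    then show ?thesis by (simp add: abs_mult mult_ac)
  qed
  then show "AE s in lborel. s \<in> {0<..<1} \<longrightarrow>
      norm (k s * u (x * s)) \<le> norm ((M * x powr p) * (k s * s powr p))"
    by simp
qed

text \<open>The majorant is a general \<phi> because the uniqueness argument compares with an affine
  function, not with a single power.\<close>

lemma scaled_mean_abs_le:
  fixes k u \<phi> :: "real \<Rightarrow> real"
  assumes k: "\<And>s. s \<in> {0<..<1} \<Longrightarrow> 0 \<le> k s"
    and u: "set_integrable lborel {0<..<1} (\<lambda>s. k s * u (x * s))"
    and \<phi>: "set_integrable lborel {0<..<1} (\<lambda>s. k s * \<phi> (x * s))"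
    and le: "\<And>s. s \<in> {0<..<1} \<Longrightarrow> \<bar>u (x * s)\<bar> \<le> \<phi> (x * s)"
  shows "\<bar>scaled_mean k u x\<bar> \<le> scaled_mean k \<phi> x"
proof -
  have "\<bar>scaled_mean k u x\<bar> \<le> (LINT s:{0<..<1}|lborel. \<bar>k s * u (x * s)\<bar>)"
    unfolding scaled_mean_def set_lebesgue_integral_def
    by (rule order_trans[OF integral_abs_bound]) (simp add: abs_mult)
  also have "\<dots> \<le> (LINT s:{0<..<1}|lborel. k s * \<phi> (x * s))"
    using k le
    by (intro set_integral_mono set_integrable_abs u \<phi>) (auto simp: abs_mult intro!: mult_left_mono)
  finally show ?thesis by (simp add: scaled_mean_def)
qed

text \<open>Powers are eigenfunctions: (x s)^p = x^p s^p, and integrating over s leaves a factor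
  free of x.\<close>

lemma scaled_mean_bound:
  fixes k u :: "real \<Rightarrow> real"
  assumes k: "continuous_on {0<..<1} k" "\<And>s. s \<in> {0<..<1} \<Longrightarrow> 0 \<le> k s"
    and u: "continuous_on {0<..T} u"
    and bnd: "\<And>r. r \<in> {0<..T} \<Longrightarrow> \<bar>u r\<bar> \<le> M * r powr p"
    and int: "set_integrable lborel {0<..<1} (\<lambda>s. k s * s powr p)"
    and x: "x \<in> {0<..T}"
  shows "\<bar>scaled_mean k u x\<bar> \<le> M * (LINT s:{0<..<1}|lborel. k s * s powr p) * x powr p"
proof -
  have eq: "k s * (M * (x * s) powr p) = (M * x powr p) * (k s * s powr p)" if "s \<in> {0<..<1}" for s
    using that x by (simp add: powr_mult)
  have "\<bar>scaled_mean k u x\<bar> \<le> scaled_mean k (\<lambda>r. M * r powr p) x"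
  proof (rule scaled_mean_abs_le[OF k(2) scaled_mean_integrable[OF k(1) u bnd int x]])
    show "set_integrable lborel {0<..<1} (\<lambda>s. k s * (M * (x * s) powr p))"
      by (subst set_integrable_cong[OF refl refl eq]) (assumption | intro set_integrable_mult_right int)+
  qed (use bnd mult_unit_mem_Ioc[OF x] in auto)
  also have "\<dots> = (LINT s:{0<..<1}|lborel. (M * x powr p) * (k s * s powr p))"
    unfolding scaled_mean_def using eq by (intro set_lebesgue_integral_cong) auto
  also have "\<dots> = M * (LINT s:{0<..<1}|lborel. k s * s powr p) * x powr p"
    unfolding set_integral_mult_right by (simp only: mult_ac)
  finally show ?thesis .
qed

text \<open>Dominated convergence along a sequence: kernel and domain do not move, so continuity of
  u and a majorant uniform in n suffice.\<close>

lemma scaled_mean_continuous: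
  fixes k u :: "real \<Rightarrow> real"
  assumes k: "continuous_on {0<..<1} k" and u: "continuous_on {0<..T} u"
    and bnd: "\<And>r. r \<in> {0<..T} \<Longrightarrow> \<bar>u r\<bar> \<le> M * r powr p"
    and int: "set_integrable lborel {0<..<1} (\<lambda>s. k s * s powr p)"
  shows "continuous_on {0<..T} (scaled_mean k u)"
proof (rule continuous_on_sequentiallyI)
  fix X :: "nat \<Rightarrow> real" and a
  assume X: "\<forall>n. X n \<in> {0<..T}" and a: "a \<in> {0<..T}" and lim: "X \<longlonglongrightarrow> a"
  have in': "x * s \<in> {0<..T}" if "s \<in> {0<..<1}" "x \<in> {0<..T}" for s x
    using mult_unit_mem_Ioc that by blast
  \<comment> \<open>Since a > 0, these powers converge and are bounded even for p < 0; their bound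
    \<open>B\<close> makes the majorant independent of n.\<close>
  have "(\<lambda>n. X n powr p) \<longlonglongrightarrow> a powr p"
    using a by (intro tendsto_powr lim tendsto_const) auto
  then have "Bseq (\<lambda>n. X n powr p)" by (rule convergentI[THEN convergent_imp_Bseq])
  then obtain B where B: "\<And>n. X n powr p \<le> B" by (auto simp: Bseq_def)
  then have "0 \<le> B" using order_trans[OF powr_ge_zero B] by blast
  have meas: "(\<lambda>s. indicator {0<..<1} s *\<^sub>R (k s * u (x * s))) \<in> borel_measurable lborel"
    if "x \<in> {0<..T}" for x
    using scaled_mean_integrable[OF k u bnd int that]
    by (auto simp: set_integrable_def)
  show "(\<lambda>n. scaled_mean k u (X n)) \<longlonglongrightarrow> scaled_mean k u a"
    unfolding scaled_mean_def set_lebesgue_integral_def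
  proof (rule integral_dominated_convergence)
    show "integrable lborel (\<lambda>s. \<bar>M\<bar> * B * \<bar>indicator {0<..<1} s *\<^sub>R (k s * s powr p)\<bar>)"
      using int unfolding set_integrable_def by (intro integrable_mult_right integrable_abs)
    have "(\<lambda>n. k s * u (X n * s)) \<longlonglongrightarrow> k s * u (a * s)" if "s \<in> {0<..<1}" for s
    proof -
      have "(\<lambda>n. X n * s) \<longlonglongrightarrow> a * s" by (intro tendsto_intros lim)
      then have "(\<lambda>n. u (X n * s)) \<longlonglongrightarrow> u (a * s)"
        using u in'[OF that] a X by (intro continuous_on_tendsto_compose[OF u]) auto
      then show ?thesis by (intro tendsto_intros)
    qed
    then show "AE s in lborel. (\<lambda>n. indicator {0<..<1} s *\<^sub>R (k s * u (X n * s)))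
        \<longlonglongrightarrow> indicator {0<..<1} s *\<^sub>R (k s * u (a * s))"
      by (auto simp: indicator_def)
    fix n
    have "\<bar>k s * u (X n * s)\<bar> \<le> \<bar>M\<bar> * B * \<bar>k s * s powr p\<bar>" if s: "s \<in> {0<..<1}" for s
    proof -
      have "\<bar>u (X n * s)\<bar> \<le> M * (X n * s) powr p"
        using bnd[OF in'[OF s]] X by auto
      also have "\<dots> = M * (X n powr p * s powr p)"
        using X s by (simp add: powr_mult)
      also have "\<dots> \<le> \<bar>M\<bar> * (B * s powr p)"
        using B[of n] \<open>0 \<le> B\<close> by (intro mult_mono) auto
      finally have "\<bar>k s\<bar> * \<bar>u (X n * s)\<bar> \<le> \<bar>k s\<bar> * (\<bar>M\<bar> * (B * s powr p))"
        by (intro mult_left_mono) auto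
      then show ?thesis by (simp add: abs_mult mult_ac)
    qed
    then show "AE s in lborel. norm (indicator {0<..<1} s *\<^sub>R (k s * u (X n * s)))
        \<le> \<bar>M\<bar> * B * \<bar>indicator {0<..<1} s *\<^sub>R (k s * s powr p)\<bar>"
      by (auto simp: indicator_def)
  qed (use meas a X in auto)
qed

section \<open>Riemann--Liouville integrals\<close>

text \<open>Mapping (r, x) to (0, 1) gives \<open>Beta (1 - a) a\<close>, and the powers of x - r
  cancel: 1 + (a - 1) - a = 0. The value is therefore the same for all r < x.\<close>

lemma RL_kernel_integral:
  fixes a :: real
  assumes a: "0 < a" "a < 1" and rx: "r < x"
  shows "set_integrable lborel {r<..<x} (\<lambda>s. (x - s) powr (a - 1) * (s - r) powr (- a))"
    and "(LINT s:{r<..<x}|lborel. (x - s) powr (a - 1) * (s - r) powr (- a)) = Gamma a * Gamma (1 - a)"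
proof -
  have eq: "(x - (r + (x - r) * s)) powr (a - 1) * ((r + (x - r) * s) - r) powr (- a)
      = inverse (x - r) * (s powr ((1 - a) - 1) * (1 - s) powr (a - 1))" if "s \<in> {0<..<1}" for s
  proof -
    have "x - (r + (x - r) * s) = (x - r) * (1 - s)" by (simp add: algebra_simps)
    moreover have "(x - r) powr (a - 1) * (x - r) powr (- a) = inverse (x - r)"
      using rx powr_add[of "x - r" "a - 1" "- a"] by (simp add: powr_neg_one inverse_eq_divide)
    ultimately show ?thesis
      using that rx by (simp add: powr_mult mult_ac)
  qed
  note B = has_Beta_integral_lborel[of "1 - a" a]
  show "set_integrable lborel {r<..<x} (\<lambda>s. (x - s) powr (a - 1) * (s - r) powr (- a))"
    using B(1) a
    by (subst set_integrable_affine_unit[OF rx])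
       (subst set_integrable_cong[OF refl refl eq], auto)
  have "(LINT s:{r<..<x}|lborel. (x - s) powr (a - 1) * (s - r) powr (- a))
     = (x - r) * (LINT s:{0<..<1}|lborel. inverse (x - r) * (s powr ((1 - a) - 1) * (1 - s) powr (a - 1)))"
    unfolding set_integral_affine_unit[OF rx]
    using eq by (intro arg_cong[where f = "(*) (x - r)"] set_lebesgue_integral_cong allI impI) auto
  also have "\<dots> = Beta (1 - a) a"
    using rx B(2) a by simp
  finally show "(LINT s:{r<..<x}|lborel. (x - s) powr (a - 1) * (s - r) powr (- a))
      = Gamma a * Gamma (1 - a)"
    by (simp add: Beta_def mult.commute)
qed

text \<open>Fubini on 0 < r < s < x: the inner integral over s is the kernel integral, which the two
  Gamma factors normalise to 1.\<close>

lemma RL_integral_compose_complementary: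
  fixes a :: real
  assumes a: "0 < a" "a < 1" and u: "set_integrable lborel {0<..<x} u"
  shows "RL_integral a (RL_integral (1 - a) u) x = (LINT r:{0<..<x}|lborel. u r)"
proof -
  \<comment> \<open>Extending u by 0, and putting an indicator into the kernel \<open>k\<close>,
    places the double integral on the whole plane.\<close>
  define U where "U = (\<lambda>r. indicator {0<..<x} r *\<^sub>R u r)"
  have U_int: "integrable lborel U" using u by (simp add: U_def set_integrable_def)
  then have [measurable]: "U \<in> borel_measurable borel" by auto
  define G where "G = Gamma a * Gamma (1 - a)"
  have "0 < G" using a by (simp add: G_def Gamma_real_pos)
  define k where "k = (\<lambda>r s. indicator {r<..<x} s * ((x - s) powr (a - 1) * (s - r) powr (- a)) / G)"
  \<comment> \<open>The conditional form exhibits joint measurability in r and s.\<close>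
  have k_alt: "k = (\<lambda>r s. (if r < s \<and> s < x then (x - s) powr (a - 1) * (s - r) powr (- a) / G else 0))"
    by (auto simp: k_def fun_eq_iff)
  have [measurable]: "(\<lambda>p. k (fst p) (snd p)) \<in> borel_measurable (lborel \<Otimes>\<^sub>M lborel)"
    unfolding k_alt by measurable
  have k_nonneg: "0 \<le> k r s" for r s
    using \<open>0 < G\<close> by (simp add: k_def)
  have k_int: "integrable lborel (k r)" and k_one: "(\<integral>s. k r s \<partial>lborel) = 1"
    if "r < x" for r
    using RL_kernel_integral[OF a that] \<open>0 < G\<close>
    by (auto simp: k_def set_integrable_def set_lebesgue_integral_def G_def)
  have U0: "U r = 0" if "\<not> r < x" for r using that by (simp add: U_def)
  \<comment> \<open>A general \<open>c\<close> serves both \<bar>U\<bar> (integrability) and U (the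
    value); for r \<ge> x both sides vanish.\<close>
  have total: "(\<integral>s. k r s * c r \<partial>lborel) = c r" if "c r = 0 \<or> r < x" for c :: "real \<Rightarrow> real" and r
    using that k_one[of r] by auto
  have F: "integrable (lborel \<Otimes>\<^sub>M lborel) (case_prod (\<lambda>r s. k r s * U r))"
  proof (rule lborel_pair.Fubini_integrable)
    show "(\<lambda>(r, s). k r s * U r) \<in> borel_measurable (lborel \<Otimes>\<^sub>M lborel)"
      unfolding case_prod_beta by measurable
    have "(\<integral>s. norm (case (r, s) of (r, s) \<Rightarrow> k r s * U r) \<partial>lborel) = \<bar>U r\<bar>" for r
      using total[of "\<lambda>r. \<bar>U r\<bar>" r] k_nonneg U0[of r] by (simp add: abs_mult del: integral_mult_left_zero) auto
    then show "integrable lborel (\<lambda>r. \<integral>s. norm (case (r, s) of (r, s) \<Rightarrow> k r s * U r) \<partial>lborel)"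
      using U_int by simp
    have "integrable lborel (\<lambda>s. k r s * U r)" for r
      using U0[of r] k_int[of r] by (cases "r < x") auto
    then show "AE r in lborel. integrable lborel (\<lambda>s. case (r, s) of (r, s) \<Rightarrow> k r s * U r)"
      by simp
  qed
  have "RL_integral a (RL_integral (1 - a) u) x = (\<integral>s. \<integral>r. k r s * U r \<partial>lborel \<partial>lborel)"
    unfolding RL_integral_def set_lebesgue_integral_def
  proof (rule Bochner_Integration.integral_cong[OF refl])
    fix s :: real
    \<comment> \<open>Both sides live on 0 < r < s < x, read once as r < x with r < s < x, once as s
      < x with r < s.\<close>
    have "k r s * U r = indicator {0<..<x} s * ((x - s) powr (a - 1) / Gamma a) *
        (indicator {0<..<s} r * ((s - r) powr (1 - a - 1) / Gamma (1 - a) * u r))" for r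
      by (auto simp: k_def U_def G_def indicator_def)
    then show "indicat_real {0<..<x} s *\<^sub>R ((x - s) powr (a - 1) / Gamma a *
         (\<integral>r. indicat_real {0<..<s} r *\<^sub>R ((s - r) powr (1 - a - 1) / Gamma (1 - a) * u r) \<partial>lborel))
      = (\<integral>r. k r s * U r \<partial>lborel)"
      by simp
  qed
  also have "\<dots> = (\<integral>r. \<integral>s. k r s * U r \<partial>lborel \<partial>lborel)"
    by (rule lborel_pair.Fubini_integral[OF F])
  also have "\<dots> = (\<integral>r. U r \<partial>lborel)"
    by (intro Bochner_Integration.integral_cong refl total) (use U0 in auto)
  finally show ?thesis by (simp add: U_def set_lebesgue_integral_def)
qed

section \<open>Riemann-Liouville integrals of functions of power growth\<close>

lemma RL_weight_integral:
  fixes \<gamma> p :: real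
  assumes "0 < \<gamma>" "-1 < p"
  shows "set_integrable lborel {0<..<1} (\<lambda>s. (1 - s) powr (\<gamma> - 1) / Gamma \<gamma> * s powr p)"
  using has_Beta_integral_lborel(1)[of "p + 1" \<gamma>] assms
  by (auto simp: mult.commute[of _ "_ powr p"] intro: set_integrable_divide)

lemma RL_weight_continuous:
  fixes \<gamma> :: real
  assumes "0 < \<gamma>"
  shows "continuous_on {0<..<1} (\<lambda>s. (1 - s) powr (\<gamma> - 1) / Gamma \<gamma>)"
  using Gamma_real_pos[OF assms] by (auto intro!: continuous_intros)

lemma RL_integrable:
  fixes \<gamma> p :: real
  assumes "0 < \<gamma>" "-1 < p" and u: "continuous_on {0<..T} u"
    and bnd: "\<And>r. r \<in> {0<..T} \<Longrightarrow> \<bar>u r\<bar> \<le> M * r powr p" and x: "x \<in> {0<..T}"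
  shows "set_integrable lborel {0<..<x} (\<lambda>r. (x - r) powr (\<gamma> - 1) / Gamma \<gamma> * u r)"
proof -
  have eq: "(x - (0 + (x - 0) * s)) powr (\<gamma> - 1) / Gamma \<gamma> * u (0 + (x - 0) * s)
      = x powr (\<gamma> - 1) * ((1 - s) powr (\<gamma> - 1) / Gamma \<gamma> * u (x * s))" if "s \<in> {0<..<1}" for s
  proof -
    have "x - x * s = x * (1 - s)" by (simp add: algebra_simps)
    then show ?thesis using that x by (simp add: powr_mult)
  qed
  have "set_integrable lborel {0<..<1} (\<lambda>s. (1 - s) powr (\<gamma> - 1) / Gamma \<gamma> * u (x * s))"
    by (rule scaled_mean_integrable[OF RL_weight_continuous[OF assms(1)] u bnd
          RL_weight_integral[OF assms(1,2)] x])
  then show ?thesis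
    using x by (subst set_integrable_affine_unit)
      (simp, subst set_integrable_cong[OF refl refl eq], assumption, rule set_integrable_mult_right)
qed

lemma RL_continuous:
  fixes \<gamma> p :: real
  assumes "0 < \<gamma>" "-1 < p" and u: "continuous_on {0<..T} u"
    and bnd: "\<And>r. r \<in> {0<..T} \<Longrightarrow> \<bar>u r\<bar> \<le> M * r powr p"
  shows "continuous_on {0<..T} (RL_integral \<gamma> u)"
proof -
  have "continuous_on {0<..T} (\<lambda>x. x powr \<gamma> * scaled_mean (\<lambda>s. (1 - s) powr (\<gamma> - 1) / Gamma \<gamma>) u x)"
    by (intro continuous_intros scaled_mean_continuous[OF RL_weight_continuous[OF assms(1)] u bnd
          RL_weight_integral[OF assms(1,2)]]) auto
  then show ?thesis
    by (rule continuous_on_eq) (simp add: RL_integral_eq_scaled_mean)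
qed

text \<open>For 0 < \<gamma> and -1 < p this is \<Gamma>(p + 1) / \<Gamma>(\<gamma> + p + 1), the
  factor with which J^\<gamma> maps r^p to x^(\<gamma> + p).\<close>

definition RL_moment :: "real \<Rightarrow> real \<Rightarrow> real" where
  "RL_moment \<gamma> p = (LINT s:{0<..<1}|lborel. (1 - s) powr (\<gamma> - 1) / Gamma \<gamma> * s powr p)"

lemma set_integral_nonneg_real:
  fixes f :: "real \<Rightarrow> real"
  assumes "\<And>x. x \<in> A \<Longrightarrow> 0 \<le> f x"
  shows "0 \<le> (LINT x:A|M. f x)"
  unfolding set_lebesgue_integral_def
  using assms by (intro Bochner_Integration.integral_nonneg) (auto simp: indicator_def)

lemma RL_moment_nonneg: "0 < \<gamma> \<Longrightarrow> 0 \<le> RL_moment \<gamma> p"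
  unfolding RL_moment_def by (intro set_integral_nonneg_real) (simp add: Gamma_real_nonneg)

text \<open>J^\<gamma> raises the growth exponent by \<gamma>. For \<gamma> = \<beta>, p = \<alpha>
  - \<beta> yields decay like x^\<alpha>, and p = -\<beta> yields boundedness.\<close>

lemma RL_bound:
  fixes \<gamma> p :: real
  assumes "0 < \<gamma>" "-1 < p" and u: "continuous_on {0<..T} u"
    and bnd: "\<And>r. r \<in> {0<..T} \<Longrightarrow> \<bar>u r\<bar> \<le> M * r powr p" and x: "x \<in> {0<..T}"
  shows "\<bar>RL_integral \<gamma> u x\<bar> \<le> M * RL_moment \<gamma> p * x powr (\<gamma> + p)"
proof -
  have "\<bar>scaled_mean (\<lambda>s. (1 - s) powr (\<gamma> - 1) / Gamma \<gamma>) u x\<bar> \<le> M * RL_moment \<gamma> p * x powr p"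
    unfolding RL_moment_def
    by (rule scaled_mean_bound[OF RL_weight_continuous[OF assms(1)] _ u bnd
          RL_weight_integral[OF assms(1,2)] x])
       (use assms(1) in \<open>auto simp: Gamma_real_nonneg\<close>)
  then have "x powr \<gamma> * \<bar>scaled_mean (\<lambda>s. (1 - s) powr (\<gamma> - 1) / Gamma \<gamma>) u x\<bar>
      \<le> x powr \<gamma> * (M * RL_moment \<gamma> p * x powr p)"
    by (intro mult_left_mono) auto
  then show ?thesis
    using x by (simp add: RL_integral_eq_scaled_mean abs_mult powr_add mult_ac)
qed

text \<open>Two growth exponents, because the right-hand sides subtracted later have different
  singularities at 0.\<close>

lemma RL_diff:
  fixes \<gamma> p :: real
  assumes "0 < \<gamma>" "-1 < p" "-1 < q" and u: "continuous_on {0<..T} u" "continuous_on {0<..T} v"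
    and bnd: "\<And>r. r \<in> {0<..T} \<Longrightarrow> \<bar>u r\<bar> \<le> M * r powr p"
             "\<And>r. r \<in> {0<..T} \<Longrightarrow> \<bar>v r\<bar> \<le> N * r powr q" and x: "x \<in> {0<..T}"
  shows "RL_integral \<gamma> (\<lambda>r. u r - v r) x = RL_integral \<gamma> u x - RL_integral \<gamma> v x"
  unfolding RL_integral_def right_diff_distrib
  using RL_integrable[OF assms(1,2) u(1) bnd(1) x] RL_integrable[OF assms(1,3) u(2) bnd(2) x]
  by (rule set_integral_diff)

lemma RL_cong:
  assumes "\<And>r. r \<in> {0<..<x} \<Longrightarrow> u r = v r"
  shows "RL_integral \<gamma> u x = RL_integral \<gamma> v x"
  unfolding RL_integral_def using assms by (intro set_lebesgue_integral_cong) auto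

text \<open>The kernel (x - r)^0 / \<Gamma>(1) is 1 on the open interval; r = x, where
  \<open>0 powr 0 = 0\<close>, is excluded. Estimates for J^\<gamma> thus cover plain
  integrals.\<close>

lemma set_integral_eq_RL_1: "(LINT r:{0<..<x}|lborel. u r) = RL_integral 1 u x"
  unfolding RL_integral_def by (intro set_lebesgue_integral_cong) auto

lemma RL_0: "RL_integral \<gamma> u 0 = 0"
  by (simp add: RL_integral_def set_lebesgue_integral_def)

lemma set_integrable_of_power_bound:
  fixes p :: real
  assumes "-1 < p" "continuous_on {0<..T} u"
    and "\<And>r. r \<in> {0<..T} \<Longrightarrow> \<bar>u r\<bar> \<le> M * r powr p" and "x \<in> {0<..T}"
  shows "set_integrable lborel {0<..<x} u"
proof -
  have eq: "(x - r) powr (1 - 1) / Gamma 1 * u r = u r" if "r \<in> {0<..<x}" for r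
    using that by simp
  have "set_integrable lborel {0<..<x} (\<lambda>r. (x - r) powr (1 - 1) / Gamma 1 * u r)"
    by (rule RL_integrable[OF zero_less_one assms])
  then show ?thesis
    by (subst (asm) set_integrable_cong[OF refl refl eq])
qed

lemma RL_complementary:
  fixes p :: real
  assumes "0 < a" "a < 1" "-1 < p" "continuous_on {0<..T} u"
    and "\<And>r. r \<in> {0<..T} \<Longrightarrow> \<bar>u r\<bar> \<le> M * r powr p" and "x \<in> {0<..T}"
  shows "RL_integral a (RL_integral (1 - a) u) x = RL_integral 1 u x"
  using RL_integral_compose_complementary[OF assms(1,2) set_integrable_of_power_bound[OF assms(3-6)]]
  by (simp add: set_integral_eq_RL_1)

section \<open>Differentiation on the half-open interval\<close>

text \<open>As u may be singular at 0, the integral is split at an interior point d < x; the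
  fundamental theorem applies on [d, T], and the part over (0, d) is constant.\<close>

lemma RL_1_has_real_derivative:
  fixes p :: real
  assumes p: "-1 < p" and u: "continuous_on {0<..T} u"
    and bnd: "\<And>r. r \<in> {0<..T} \<Longrightarrow> \<bar>u r\<bar> \<le> M * r powr p" and x: "x \<in> {0<..T}"
  shows "(RL_integral 1 u has_real_derivative u x) (at x within {0<..T})"
proof -
  define d where "d = x / 2"
  have d: "0 < d" "d < x" "d < T" using x by (auto simp: d_def)
  have cont: "continuous_on {d..T} u" by (rule continuous_on_subset[OF u]) (use d in auto)
  have split: "integral {d..y} u + RL_integral 1 u d = RL_integral 1 u y" if y: "y \<in> {d..T}" for y
  proof -
    have int: "set_integrable lborel {0<..<y} u" "set_integrable lborel {d..<y} u"
        "set_integrable lborel {d..y} u" "set_integrable lborel {0<..<d} u"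
      using y d set_integrable_of_power_bound[OF p u bnd, of y] 
        borel_integrable_atLeastAtMost'[OF continuous_on_subset[OF cont], of d y]
      by (auto intro: set_integrable_subset)
    have "integral {d..y} u = (LINT r:{d..y}|lborel. u r)"
      using set_borel_integral_eq_integral(2)[OF int(3)] by simp
    also have "\<dots> = (LINT r:{d..<y}|lborel. u r)"
    proof (rule set_integral_cong_set)
      have "AE r in lborel. r \<noteq> y" by (rule AE_lborel_singleton)
      then show "AE r in lborel. (r \<in> {d..<y}) = (r \<in> {d..y})"
        by eventually_elim auto
    qed (use int in \<open>auto simp: set_integrable_def set_borel_measurable_def\<close>)
    finally have "integral {d..y} u = (LINT r:{d..<y}|lborel. u r)" .
    moreover have "(LINT r:{0<..<d} \<union> {d..<y}|lborel. u r)
        = (LINT r:{0<..<d}|lborel. u r) + (LINT r:{d..<y}|lborel. u r)"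
      using int by (intro set_integral_Un) auto
    moreover have "{0<..<d} \<union> {d..<y} = {0<..<y}" using d y by auto
    ultimately show ?thesis by (simp add: set_integral_eq_RL_1)
  qed
  have "((\<lambda>y. integral {d..y} u + RL_integral 1 u d) has_real_derivative u x) (at x within {d..T})"
    using integral_has_real_derivative[OF cont, of x] d x
    by (auto intro!: derivative_eq_intros)
  then have "(RL_integral 1 u has_real_derivative u x) (at x within {d..T})"
    by (rule has_field_derivative_transform_within[OF _ zero_less_one]) (use split d x in auto)
  \<comment> \<open>Differentiability at x is local, and (d, \<infinity>) is a neighbourhood of
    x.\<close>
  moreover have "at x within {d..T} = at x within {0<..T}"
    by (rule at_within_nhd[of x "{d<..}"]) (use d in auto)
  ultimately show ?thesis by simp
qed

text \<open>Makes derivatives within (0, T] unique. Approach from the left is available at every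
  such x, including the end point T.\<close>

lemma at_within_Ioc_nontrivial:
  fixes x T :: real
  assumes "x \<in> {0<..T}"
  shows "at x within {0<..T} \<noteq> bot"
proof -
  have "x islimpt {0<..<x}" using assms by (intro islimpt_greaterThanLessThan2) auto
  then have "x islimpt {0<..T}" by (rule islimpt_subset) (use assms in auto)
  then show ?thesis by (simp add: trivial_limit_within)
qed

lemma has_real_derivative_imp_vector_derivative_Ioc:
  assumes "(f has_real_derivative y) (at x within {0<..T})" "x \<in> {0<..T}"
  shows "vector_derivative f (at x within {0<..T}) = y"
  using assms at_within_Ioc_nontrivial
  by (intro vector_derivative_within) (auto simp: has_real_derivative_iff_has_vector_derivative)

section \<open>Behaviour at the left end point\<close>

lemma tendsto_powr_at_right_0:
  assumes "(0::real) < a"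
  shows "((\<lambda>x. C * x powr a) \<longlongrightarrow> 0) (at 0 within {0<..T})"
proof -
  have "((\<lambda>x. C * x powr a) \<longlongrightarrow> C * 0 powr a) (at 0 within {0<..T})"
    by (intro tendsto_intros tendsto_powr') (use assms in \<open>auto simp: eventually_at_filter\<close>)
  then show ?thesis by simp
qed

text \<open>Let x tend to 0. This removes the constant of integration in the initial value
  problem.\<close>

lemma const_eq_0_of_power_bound:
  fixes c :: real
  assumes "0 < a" "0 < T" "\<And>x. x \<in> {0<..T} \<Longrightarrow> \<bar>c\<bar> \<le> C * x powr a"
  shows "c = 0"
proof -
  have "(0::real) islimpt {0<..<T}" using assms by (intro islimpt_greaterThanLessThan1) auto
  then have "(0::real) islimpt {0<..T}" by (rule islimpt_subset) auto
  then have nt: "at (0::real) within {0<..T} \<noteq> bot" by (simp add: trivial_limit_within)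
  have "\<forall>\<^sub>F x in at 0 within {0<..T}. \<bar>c\<bar> \<le> C * x powr a"
    using assms by (auto simp: eventually_at_filter)
  then have "\<bar>c\<bar> \<le> 0"
    using tendsto_lowerbound[OF tendsto_powr_at_right_0[OF assms(1)] _ nt] by blast
  then show ?thesis by simp
qed

lemma continuous_on_Icc_of_power_bound:
  fixes f :: "real \<Rightarrow> real"
  assumes f: "continuous_on {0<..T} f" and "0 < a"
    and bnd: "\<And>x. x \<in> {0<..T} \<Longrightarrow> \<bar>f x\<bar> \<le> C * x powr a" and f0: "f 0 = 0"
  shows "continuous_on {0..T} f"
  unfolding continuous_on_def
proof
  fix x assume x: "x \<in> {0..T}"
  show "(f \<longlongrightarrow> f x) (at x within {0..T})"
  proof (cases "x = 0")
    case True
    have "((\<lambda>x. C * x powr a) \<longlongrightarrow> 0) (at 0 within {0<..T})"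
      by (rule tendsto_powr_at_right_0[OF \<open>0 < a\<close>])
    then have "(f \<longlongrightarrow> 0) (at 0 within {0<..T})"
      by (rule Lim_null_comparison[rotated]) (use bnd in \<open>auto simp: eventually_at_filter\<close>)
    \<comment> \<open>The filter at 0 ignores the point 0 itself, so adding it to the set changes
      nothing.\<close>
    moreover have "at 0 within {0<..T} = at 0 within {0..T}"
      unfolding at_within_def by (rule arg_cong[where f = "\<lambda>A. inf (nhds 0) (principal A)"]) auto
    ultimately show ?thesis using True f0 by simp
  next
    case False
    then have "at x within {0..T} = at x within {0<..T}"
      using x by (intro at_within_nhd[of x "{0<..}"]) auto
    then show ?thesis using f x False by (auto simp: continuous_on_def)
  qed
qed

lemma continuous_on_Icc_bounded:
  fixes u :: "real \<Rightarrow> real"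
  assumes "continuous_on {0..T} u"
  obtains m where "\<And>x. x \<in> {0..T} \<Longrightarrow> \<bar>u x\<bar> \<le> m"
proof -
  have "bounded (u ` {0..T})"
    by (intro compact_imp_bounded compact_continuous_image assms) auto
  then show ?thesis using that unfolding bounded_iff by (auto simp del: atLeastAtMost_iff)
qed

section \<open>The averaging operator\<close>

text \<open>The density of the Beta(1 - \<beta>, \<beta>) distribution.\<close>

definition K_weight :: "real \<Rightarrow> real \<Rightarrow> real" where
  "K_weight \<beta> s = (1 - s) powr (\<beta> - 1) * s powr (- \<beta>) / (Gamma \<beta> * Gamma (1 - \<beta>))"

text \<open>The eigenvalue c(p) of K on the power r^p.\<close>

definition K_moment :: "real \<Rightarrow> real \<Rightarrow> real" where
  "K_moment \<beta> p = (LINT s:{0<..<1}|lborel. K_weight \<beta> s * s powr p)"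

context
  fixes \<beta> :: real
  assumes \<beta>: "0 < \<beta>" "\<beta> < 1"
begin

lemma Gamma_ne_0: "Gamma \<beta> \<noteq> 0" "Gamma (1 - \<beta>) \<noteq> 0"
  using \<beta> Gamma_real_pos[of \<beta>] Gamma_real_pos[of "1 - \<beta>"] by linarith+

lemma K_weight_pos: "s \<in> {0<..<1} \<Longrightarrow> 0 < K_weight \<beta> s"
  using \<beta> by (simp add: K_weight_def Gamma_real_pos)

lemma K_weight_continuous: "continuous_on {0<..<1} (K_weight \<beta>)"
  unfolding K_weight_def
  using \<beta> Gamma_ne_0 by (auto intro!: continuous_intros)

lemma
  assumes "0 \<le> p"
  shows K_weight_integrable: "set_integrable lborel {0<..<1} (\<lambda>s. K_weight \<beta> s * s powr p)"
    and K_moment_eq_Beta: "K_moment \<beta> p = Beta (1 - \<beta> + p) \<beta> / (Gamma \<beta> * Gamma (1 - \<beta>))"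
proof -
  have eq: "K_weight \<beta> s * s powr p = (s powr ((1 - \<beta> + p) - 1) * (1 - s) powr (\<beta> - 1)) / (Gamma \<beta> * Gamma (1 - \<beta>))"
    if "s \<in> {0<..<1}" for s
    using that by (simp add: K_weight_def powr_add[symmetric] mult_ac)
  note B = has_Beta_integral_lborel[of "1 - \<beta> + p" \<beta>]
  show "set_integrable lborel {0<..<1} (\<lambda>s. K_weight \<beta> s * s powr p)"
    by (subst set_integrable_cong[OF refl refl eq], assumption)
       (intro set_integrable_divide B, use \<beta> assms in auto)
  have "K_moment \<beta> p = (LINT s:{0<..<1}|lborel.
      (s powr ((1 - \<beta> + p) - 1) * (1 - s) powr (\<beta> - 1)) / (Gamma \<beta> * Gamma (1 - \<beta>)))"
    unfolding K_moment_def using eq by (intro set_lebesgue_integral_cong) auto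
  also have "\<dots> = Beta (1 - \<beta> + p) \<beta> / (Gamma \<beta> * Gamma (1 - \<beta>))"
    using B(2) \<beta> assms by simp
  finally show "K_moment \<beta> p = Beta (1 - \<beta> + p) \<beta> / (Gamma \<beta> * Gamma (1 - \<beta>))" .
qed

lemma K_moment_0: "K_moment \<beta> 0 = 1"
  using \<beta> Gamma_ne_0
  by (simp add: K_moment_eq_Beta Beta_def)

lemma K_moment_nonneg: "0 \<le> K_moment \<beta> p"
  unfolding K_moment_def
  by (intro set_integral_nonneg_real) (simp add: K_weight_pos less_imp_le)

lemma K_moment_pos: "0 \<le> p \<Longrightarrow> 0 < K_moment \<beta> p"
  using \<beta> by (simp add: K_moment_eq_Beta Beta_def Gamma_real_pos Gamma_ne_0)

text \<open>The strict inequality comes from \<open>s\<^sup>p (1 + p (1 - s)) \<le> 1\<close>, i.e. from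
  \<open>exp (- p ln s) \<ge> 1 - p ln s\<close> and \<open>- ln s \<ge> 1 - s\<close>.\<close>

lemma K_moment_less_1:
  assumes "0 < p"
  shows "K_moment \<beta> p < 1"
proof -
  \<comment> \<open>Expanded so that every term is a power of s: integration against the density
    gives c(p) + p c(p) \<le> 1 + p c(p + 1).\<close>
  have le: "s powr p + p * s powr p \<le> 1 + p * s powr (p + 1)" if "s \<in> {0<..<1}" for s
  proof -
    have "1 + p * (1 - s) \<le> 1 + p * (- ln s)"
      using ln_le_minus_one[of s] that assms by (intro add_left_mono mult_left_mono) auto
    also have "\<dots> \<le> exp (- (p * ln s))"
      using exp_ge_add_one_self[of "- (p * ln s)"] by simp
    finally have "s powr p * (1 + p * (1 - s)) \<le> s powr p * exp (- (p * ln s))"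
      by (intro mult_left_mono) auto
    also have "\<dots> = 1" using that by (simp add: powr_def exp_minus)
    finally show ?thesis using that by (simp add: powr_add algebra_simps)
  qed
  have int: "set_integrable lborel {0<..<1} (\<lambda>s. K_weight \<beta> s * s powr q)" if "0 \<le> q" for q
    using K_weight_integrable[OF that] .
  have le_int: "(LINT s:{0<..<1}|lborel. K_weight \<beta> s * s powr p + p * (K_weight \<beta> s * s powr p))
      \<le> (LINT s:{0<..<1}|lborel. K_weight \<beta> s * s powr 0 + p * (K_weight \<beta> s * s powr (p + 1)))"
  proof (rule set_integral_mono)
    fix s :: real assume s: "s \<in> {0<..<1}"
    show "K_weight \<beta> s * s powr p + p * (K_weight \<beta> s * s powr p)
        \<le> K_weight \<beta> s * s powr 0 + p * (K_weight \<beta> s * s powr (p + 1))"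
      using mult_left_mono[OF le[OF s] less_imp_le[OF K_weight_pos[OF s]]] s
      by (simp add: algebra_simps)
  qed (intro set_integral_add(1) set_integrable_mult_right int; use assms in simp)+
  have split: "(LINT s:{0<..<1}|lborel. K_weight \<beta> s * s powr q + p * (K_weight \<beta> s * s powr q'))
      = K_moment \<beta> q + p * K_moment \<beta> q'" if "0 \<le> q" "0 \<le> q'" for q q'
    unfolding K_moment_def
    by (subst set_integral_add(2)) (use int that in \<open>auto intro!: set_integrable_mult_right\<close>)
  have "0 \<le> p + 1" using assms by simp
  then have "K_moment \<beta> p + p * K_moment \<beta> p \<le> 1 + p * K_moment \<beta> (p + 1)"
    using le_int split[of p p] split[of 0 "p + 1"] assms unfolding K_moment_0 by linarith
  \<comment> \<open>The recurrence (a + b) B(a + 1, b) = a B(a, b) with a = 1 - \<beta> + p, b =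
    \<beta>, a + b = 1 + p. It gives c(p + 1) < c(p), which makes the integrated inequality
    strict.\<close>
  moreover have "(1 + p) * K_moment \<beta> (p + 1) = (1 + p) * K_moment \<beta> p - \<beta> * K_moment \<beta> p"
  proof -
    have "1 - \<beta> + p \<notin> \<int>\<^sub>\<le>\<^sub>0" using \<beta> assms by (auto simp: nonpos_Ints_def)
    from Beta_plus1_left[OF this, of \<beta>]
    have "(1 + p) * Beta (1 - \<beta> + (p + 1)) \<beta> = (1 + p) * Beta (1 - \<beta> + p) \<beta> - \<beta> * Beta (1 - \<beta> + p) \<beta>"
      by (simp add: algebra_simps)
    then show ?thesis
      using assms by (simp add: K_moment_eq_Beta diff_divide_distrib[symmetric])
  qed
  then have "(1 + p) * K_moment \<beta> (p + 1) < (1 + p) * K_moment \<beta> p"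
    using \<beta> K_moment_pos[of p] assms by simp
  then have "p * K_moment \<beta> (p + 1) < p * K_moment \<beta> p"
    using assms by simp
  ultimately show ?thesis by linarith
qed

text \<open>The powers x, x^(\<beta> - 1) and x^(-\<beta>) cancel, so K is scale invariant and no
  prefactor in x remains.\<close>

lemma K_op_eq_scaled_mean:
  assumes "0 < x"
  shows "K_op \<beta> \<psi> x = scaled_mean (K_weight \<beta>) \<psi> x"
proof -
  have "x * ((x - x * s) powr (\<beta> - 1) * (x * s) powr (- \<beta>) / (Gamma \<beta> * Gamma (1 - \<beta>)) * \<psi> (x * s))
          = K_weight \<beta> s * \<psi> (x * s)" if "s \<in> {0<..<1}" for s
  proof -
    have "x - x * s = x * (1 - s)" by (simp add: algebra_simps)
    then have "x * ((x - x * s) powr (\<beta> - 1) * (x * s) powr (- \<beta>) / (Gamma \<beta> * Gamma (1 - \<beta>)) * \<psi> (x * s))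
        = (x * (x powr (\<beta> - 1) * x powr (- \<beta>))) * (K_weight \<beta> s * \<psi> (x * s))"
      using that assms by (simp add: powr_mult K_weight_def mult_ac)
    also have "x * (x powr (\<beta> - 1) * x powr (- \<beta>)) = 1"
      using assms powr_add[of x "\<beta> - 1" "- \<beta>", symmetric] by (simp add: powr_neg_one)
    finally show ?thesis by simp
  qed
  then show ?thesis
    unfolding K_op_def scaled_mean_def using assms
    by (simp only: if_False less_imp_neq[symmetric] set_integral_affine_unit[OF assms] diff_zero add_0
          set_integral_mult_right[symmetric])
       (intro set_lebesgue_integral_cong, auto)
qed

context
  fixes T :: real and p :: real and \<psi> :: "real \<Rightarrow> real" and A :: real
  assumes p: "0 \<le> p" and \<psi>: "continuous_on {0<..T} \<psi>"
    and bnd: "\<And>r. r \<in> {0<..T} \<Longrightarrow> \<bar>\<psi> r\<bar> \<le> A * r powr p"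
begin

lemma K_integrable:
  assumes "x \<in> {0<..T}"
  shows "set_integrable lborel {0<..<1} (\<lambda>s. K_weight \<beta> s * \<psi> (x * s))"
  by (rule scaled_mean_integrable[OF K_weight_continuous \<psi> bnd K_weight_integrable[OF p] assms])

text \<open>For p > 0 this is the contraction estimate behind the geometric series; for p = 0 it
  preserves a uniform bound, since c(0) = 1.\<close>

lemma K_op_bound:
  assumes "x \<in> {0<..T}"
  shows "\<bar>K_op \<beta> \<psi> x\<bar> \<le> A * K_moment \<beta> p * x powr p"
proof -
  have "\<bar>scaled_mean (K_weight \<beta>) \<psi> x\<bar> \<le> A * K_moment \<beta> p * x powr p"
    unfolding K_moment_def
    by (rule scaled_mean_bound[OF K_weight_continuous _ \<psi> bnd K_weight_integrable[OF p] assms])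
       (simp add: K_weight_pos less_imp_le)
  then show ?thesis using assms by (simp add: K_op_eq_scaled_mean)
qed

lemma K_op_continuous: "continuous_on {0<..T} (K_op \<beta> \<psi>)"
  by (rule continuous_on_eq[OF scaled_mean_continuous[OF K_weight_continuous \<psi> bnd K_weight_integrable[OF p]]])
     (auto simp: K_op_eq_scaled_mean)

end

text \<open>The density has total mass 1, that is c(0) = 1.\<close>

lemma K_op_const: "0 < x \<Longrightarrow> K_op \<beta> (\<lambda>_. c) x = c"
proof -
  assume x: "0 < x"
  have "scaled_mean (K_weight \<beta>) (\<lambda>_. c) x = (LINT s:{0<..<1}|lborel. c * (K_weight \<beta> s * s powr 0))"
    unfolding scaled_mean_def by (intro set_lebesgue_integral_cong) auto
  then show ?thesis using K_moment_0 x by (simp add: K_moment_def K_op_eq_scaled_mean)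
qed

lemma K_op_diff:
  assumes x: "x \<in> {0<..T}"
    and "continuous_on {0<..T} \<phi>" "\<And>r. r \<in> {0<..T} \<Longrightarrow> \<bar>\<phi> r\<bar> \<le> A"
    and "continuous_on {0<..T} \<psi>" "\<And>r. r \<in> {0<..T} \<Longrightarrow> \<bar>\<psi> r\<bar> \<le> B"
  shows "K_op \<beta> (\<lambda>r. \<phi> r - \<psi> r) x = K_op \<beta> \<phi> x - K_op \<beta> \<psi> x"
proof -
  have "set_integrable lborel {0<..<1} (\<lambda>s. K_weight \<beta> s * \<phi> (x * s))"
    by (rule K_integrable[of 0 T _ A, OF _ assms(2) _ x]) (use assms(3) in auto)
  moreover have "set_integrable lborel {0<..<1} (\<lambda>s. K_weight \<beta> s * \<psi> (x * s))"
    by (rule K_integrable[of 0 T _ B, OF _ assms(4) _ x]) (use assms(5) in auto)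
  ultimately show ?thesis
    using x by (simp add: K_op_eq_scaled_mean scaled_mean_def right_diff_distrib set_integral_diff(2))
qed

section \<open>Uniqueness of fixed points\<close>

text \<open>K fixes constants and so does not contract the sup norm. In an affine majorant
  \<epsilon> + A x the constant part is kept, while each application of K shrinks the linear part by
  c(1).\<close>

lemma K_op_fixpoint_eq_0:
  fixes d :: "real \<Rightarrow> real"
  assumes T: "0 < T" and d: "continuous_on {0..T} d" "d 0 = 0"
    and fix_d: "\<And>x. x \<in> {0<..T} \<Longrightarrow> d x = K_op \<beta> d x"
    and x: "x \<in> {0..T}"
  shows "d x = 0"
proof (cases "x = 0")
  case False
  then have x: "x \<in> {0<..T}" using x by auto
  obtain m where m: "\<And>y. y \<in> {0..T} \<Longrightarrow> \<bar>d y\<bar> \<le> m"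
    using continuous_on_Icc_bounded[OF d(1)] by blast
  define c where "c = K_moment \<beta> 1"
  have c: "0 \<le> c" "c < 1" using K_moment_nonneg K_moment_less_1 by (auto simp: c_def)
  have d': "continuous_on {0<..T} d" by (rule continuous_on_subset[OF d(1)]) auto
  have "\<bar>d x\<bar> \<le> \<epsilon>" if \<epsilon>: "0 < \<epsilon>" for \<epsilon>
  proof -
    obtain \<delta> where \<delta>: "0 < \<delta>" "\<And>y. y \<in> {0..T} \<Longrightarrow> \<bar>y\<bar> < \<delta> \<Longrightarrow> \<bar>d y\<bar> < \<epsilon>"
      using d(1) T \<epsilon> \<open>d 0 = 0\<close> unfolding continuous_on_iff dist_real_def
      by (metis atLeastAtMost_iff diff_zero less_imp_le order_refl)
    \<comment> \<open>Chosen so that A y \<ge> m for y \<ge> \<delta>; for y < \<delta> continuity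
      at 0 already gives \<bar>d y\<bar> < \<epsilon>.\<close>
    define A where "A = m / \<delta>"
    have A: "\<bar>d y\<bar> \<le> \<epsilon> + A * c ^ n * y" if "y \<in> {0<..T}" for y n
      using that
    proof (induction n arbitrary: y)
      case 0
      have m0: "0 \<le> m" using m[of 0] T by auto
      show ?case
      proof (cases "y < \<delta>")
        case True
        have "0 \<le> A * y" using m0 \<delta> 0 by (simp add: A_def)
        then show ?thesis using \<delta>(2)[of y] True 0 by auto
      next
        case False
        then have "m * \<delta> \<le> m * y" using m0 by (intro mult_left_mono) auto
        then have "m \<le> A * y" using \<delta>(1) by (simp add: A_def field_simps)
        then show ?thesis using m[of y] 0 \<epsilon> by auto
      qed
    next
      case (Suc n)
      \<comment> \<open>Splits the majorant into the powers 0 and 1, whose eigenvalues are 1 and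
        c(1).\<close>
      have eq: "K_weight \<beta> s * (\<epsilon> + A * c ^ n * (y * s))
          = \<epsilon> * (K_weight \<beta> s * s powr 0) + (A * c ^ n * y) * (K_weight \<beta> s * s powr 1)"
        if "s \<in> {0<..<1}" for s
        using that by (simp add: algebra_simps)
      have int: "set_integrable lborel {0<..<1} (\<lambda>s. \<epsilon> * (K_weight \<beta> s * s powr 0))"
        "set_integrable lborel {0<..<1} (\<lambda>s. (A * c ^ n * y) * (K_weight \<beta> s * s powr 1))"
        by (intro set_integrable_mult_right K_weight_integrable; simp)+
      have "\<bar>scaled_mean (K_weight \<beta>) d y\<bar> \<le> scaled_mean (K_weight \<beta>) (\<lambda>r. \<epsilon> + A * c ^ n * r) y"
      proof (rule scaled_mean_abs_le)
        show "set_integrable lborel {0<..<1} (\<lambda>s. K_weight \<beta> s * d (y * s))"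
          by (rule K_integrable[of 0 T _ m, OF _ d' _ Suc.prems]) (use m in auto)
        show "set_integrable lborel {0<..<1} (\<lambda>s. K_weight \<beta> s * (\<epsilon> + A * c ^ n * (y * s)))"
          by (subst set_integrable_cong[OF refl refl eq]) (assumption | intro set_integral_add(1) int)+
      qed (use Suc mult_unit_mem_Ioc in \<open>auto simp: K_weight_pos less_imp_le simp del: greaterThanAtMost_iff\<close>)
      also have "\<dots> = (LINT s:{0<..<1}|lborel.
          \<epsilon> * (K_weight \<beta> s * s powr 0) + (A * c ^ n * y) * (K_weight \<beta> s * s powr 1))"
        unfolding scaled_mean_def using eq by (intro set_lebesgue_integral_cong) auto
      also have "\<dots> = \<epsilon> * K_moment \<beta> 0 + (A * c ^ n * y) * K_moment \<beta> 1"
        unfolding set_integral_add(2)[OF int] set_integral_mult_right K_moment_def ..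
      finally show ?case
        using fix_d[OF Suc.prems] Suc.prems
        by (simp add: K_op_eq_scaled_mean K_moment_0 c_def mult_ac)
    qed
    have "(\<lambda>n. \<epsilon> + A * c ^ n * x) \<longlonglongrightarrow> \<epsilon> + A * 0 * x"
      by (intro tendsto_intros LIMSEQ_power_zero) (use c in auto)
    then show ?thesis
      using A[OF x] by (intro tendsto_lowerbound[of _ \<epsilon> sequentially]) auto
  qed
  then have "\<bar>d x\<bar> \<le> 0" by (rule field_le_epsilon) simp
  then show ?thesis by simp
qed (use d in simp)

end

section \<open>The initial value problem\<close>

context
  fixes \<beta> T :: real
  assumes \<beta>: "0 < \<beta>" "\<beta> < 1" and T: "0 < T"
begin

context
  fixes g :: "real \<Rightarrow> real" and M \<alpha> :: real
  assumes \<alpha>: "0 < \<alpha>" and g: "continuous_on {0<..T} g"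
    and g_bound: "\<And>r. r \<in> {0<..T} \<Longrightarrow> \<bar>g r\<bar> \<le> M * r powr (\<alpha> - \<beta>)"
begin

section \<open>Equivalence with the fixed point equation\<close>

text \<open>From the equation, J^(1-\<beta>) u and J^1 h have the same derivative; the constant
  vanishes, and injectivity of J^(1-\<beta>) gives u = J^\<beta> h. Conversely, apply J^(1-\<beta>)
  to u = J^\<beta> h and differentiate.\<close>

lemma censored_ivp_solution_iff_fixpoint:
  "censored_ivp_solution \<beta> T g u0 u \<longleftrightarrow>
     continuous_on {0..T} u \<and> u 0 = u0 \<and> (\<forall>x\<in>{0<..T}. u x = RL_integral \<beta> g x + K_op \<beta> u x)"
proof (cases "continuous_on {0..T} u")
  case False
  then show ?thesis by (auto simp: censored_ivp_solution_def C_beta_closed_def)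
next
  case True
  note u = True
  have u': "continuous_on {0<..T} u" by (rule continuous_on_subset[OF u]) auto
  obtain m where m: "\<And>x. x \<in> {0..T} \<Longrightarrow> \<bar>u x\<bar> \<le> m"
    using continuous_on_Icc_bounded[OF u] by blast
  have u_bound: "\<bar>u r\<bar> \<le> m * r powr 0" if "r \<in> {0<..T}" for r
    using m[of r] that by simp
  define h where "h = (\<lambda>r. g r + r powr (- \<beta>) / Gamma (1 - \<beta>) * u r)"
  \<comment> \<open>From r^(\<alpha> - \<beta>) \<le> T^\<alpha> r^(-\<beta>) and \<bar>u\<bar>
    \<le> m: both parts of h are then bounded by multiples of r^(-\<beta>).\<close>
  define C where "C = \<bar>M\<bar> * T powr \<alpha> + m / Gamma (1 - \<beta>)"
  have h: "continuous_on {0<..T} h"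
    unfolding h_def using Gamma_ne_0[OF \<beta>] by (auto intro!: continuous_intros g u')
  have h_bound: "\<bar>h r\<bar> \<le> C * r powr (- \<beta>)" if r: "r \<in> {0<..T}" for r
  proof -
    have "\<bar>g r\<bar> \<le> M * r powr (\<alpha> - \<beta>)" by (rule g_bound[OF r])
    also have "\<dots> \<le> \<bar>M\<bar> * (T powr \<alpha> * r powr (- \<beta>))"
      using r \<alpha> powr_add[of r \<alpha> "- \<beta>"]
      by (intro mult_mono) (auto intro!: mult_right_mono powr_mono2)
    finally have "\<bar>g r\<bar> \<le> \<bar>M\<bar> * (T powr \<alpha> * r powr (- \<beta>))" .
    moreover have "\<bar>r powr (- \<beta>) / Gamma (1 - \<beta>) * u r\<bar> \<le> r powr (- \<beta>) / Gamma (1 - \<beta>) * m"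
      using m[of r] r \<beta> Gamma_real_pos[of "1 - \<beta>"]
      by (simp only: abs_mult) (intro mult_mono, auto)
    ultimately have "\<bar>g r\<bar> + \<bar>r powr (- \<beta>) / Gamma (1 - \<beta>) * u r\<bar> \<le> C * r powr (- \<beta>)"
      by (simp add: C_def algebra_simps)
    then show ?thesis unfolding h_def by linarith
  qed
  \<comment> \<open>Growth exponents of h, of g, and of the bounded functions u and J^\<beta> h, in
    this order.\<close>
  have "-1 < - \<beta>" "-1 < \<alpha> - \<beta>" "-1 < (0::real)" using \<beta> \<alpha> by auto
  note exps = this
  have RL_h: "RL_integral \<beta> h x = RL_integral \<beta> g x + K_op \<beta> u x" if x: "x \<in> {0<..T}" for x
  proof -
    have "RL_integral \<beta> h x - RL_integral \<beta> g x = RL_integral \<beta> (\<lambda>r. h r - g r) x"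
      by (rule RL_diff[OF \<beta>(1) exps(1,2) h g h_bound g_bound x, symmetric])
    \<comment> \<open>The kernel of J^\<beta> times r^(-\<beta>) / \<Gamma>(1 - \<beta>) is exactly
      the kernel of K.\<close>
    also have "\<dots> = K_op \<beta> u x"
      unfolding RL_integral_def K_op_def h_def using x
      by (auto intro!: set_lebesgue_integral_cong)
    finally show ?thesis by simp
  qed
  have Jh: "continuous_on {0<..T} (RL_integral \<beta> h)"
    by (rule RL_continuous[OF \<beta>(1) exps(1) h h_bound])
  have Jh_bound: "\<bar>RL_integral \<beta> h x\<bar> \<le> (C * RL_moment \<beta> (- \<beta>)) * x powr 0" if "x \<in> {0<..T}" for x
    using RL_bound[OF \<beta>(1) exps(1) h h_bound that] by simp
  have JJh: "RL_integral (1 - \<beta>) (RL_integral \<beta> h) x = RL_integral 1 h x" if "x \<in> {0<..T}" for x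
  proof -
    have "RL_integral (1 - \<beta>) (RL_integral (1 - (1 - \<beta>)) h) x = RL_integral 1 h x"
      by (rule RL_complementary[OF _ _ exps(1) h h_bound that]) (use \<beta> in auto)
    then show ?thesis by simp
  qed
  have D_J1h: "(RL_integral 1 h has_real_derivative h x) (at x within {0<..T})" if "x \<in> {0<..T}" for x
    by (rule RL_1_has_real_derivative[OF exps(1) h h_bound that])
  show ?thesis
  proof
    assume sol: "censored_ivp_solution \<beta> T g u0 u"
    then obtain f' where f': "\<And>x. x \<in> {0<..T} \<Longrightarrow>
        (RL_integral (1 - \<beta>) u has_real_derivative f' x) (at x within {0<..T})"
      unfolding censored_ivp_solution_def C_beta_closed_def C_beta_half_open_def C1_half_open_def
      by blast
    have f'_eq: "f' x = h x" if x: "x \<in> {0<..T}" for x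
    proof -
      have "censored_deriv \<beta> T u x = g x" using sol x by (simp add: censored_ivp_solution_def)
      then show ?thesis
        using has_real_derivative_imp_vector_derivative_Ioc[OF f'[OF x] x]
        by (simp add: censored_deriv_def RL_deriv_def h_def)
    qed
    have "\<exists>c. \<forall>x\<in>{0<..T}. RL_integral (1 - \<beta>) u x - RL_integral 1 h x = c"
    proof (rule has_field_derivative_zero_constant)
      fix x assume x: "x \<in> {0<..T}"
      show "((\<lambda>x. RL_integral (1 - \<beta>) u x - RL_integral 1 h x) has_real_derivative 0) (at x within {0<..T})"
        using DERIV_diff[OF f'[OF x] D_J1h[OF x]] f'_eq[OF x] by simp
    qed simp
    then obtain c where c: "\<And>x. x \<in> {0<..T} \<Longrightarrow> RL_integral (1 - \<beta>) u x - RL_integral 1 h x = c"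
      by blast
    \<comment> \<open>Both integrals are O(x^(1 - \<beta>)) at 0.\<close>
    have "c = 0"
    proof (rule const_eq_0_of_power_bound[OF _ T])
      show "0 < 1 - \<beta>" using \<beta> by simp
      fix x assume x: "x \<in> {0<..T}"
      have "\<bar>RL_integral (1 - \<beta>) u x\<bar> \<le> m * RL_moment (1 - \<beta>) 0 * x powr (1 - \<beta>)"
        using RL_bound[OF _ exps(3) u' u_bound x, of "1 - \<beta>"] \<beta> by simp
      moreover have "\<bar>RL_integral 1 h x\<bar> \<le> C * RL_moment 1 (- \<beta>) * x powr (1 - \<beta>)"
        using RL_bound[OF zero_less_one exps(1) h h_bound x] by simp
      ultimately show "\<bar>c\<bar> \<le> (m * RL_moment (1 - \<beta>) 0 + C * RL_moment 1 (- \<beta>)) * x powr (1 - \<beta>)"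
        using c[OF x] unfolding distrib_right by linarith
    qed
    \<comment> \<open>Injectivity of J^(1-\<beta>): it annihilates D, so applying J^\<beta> gives
      J^1 D = 0, and differentiating gives D = 0.\<close>
    define D where "D = (\<lambda>x. u x - RL_integral \<beta> h x)"
    have D: "continuous_on {0<..T} D" unfolding D_def by (intro continuous_intros u' Jh)
    have D_bound: "\<bar>D x\<bar> \<le> (m + C * RL_moment \<beta> (- \<beta>)) * x powr 0" if "x \<in> {0<..T}" for x
      using u_bound[OF that] Jh_bound[OF that] unfolding D_def distrib_right by linarith
    have "RL_integral (1 - \<beta>) D x = 0" if x: "x \<in> {0<..T}" for x
      unfolding D_def
      using RL_diff[OF _ exps(3) exps(3) u' Jh u_bound Jh_bound x, of "1 - \<beta>"] c[OF x] \<open>c = 0\<close> JJh[OF x] \<beta>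
      by simp
    then have "RL_integral \<beta> (RL_integral (1 - \<beta>) D) x = RL_integral \<beta> (\<lambda>_. 0) x" if x: "x \<in> {0<..T}" for x
      using x by (intro RL_cong) auto
    moreover have "RL_integral \<beta> (\<lambda>_. 0) x = 0" for x by (simp add: RL_integral_def)
    ultimately have J1D: "RL_integral 1 D x = 0" if x: "x \<in> {0<..T}" for x
      using RL_complementary[OF \<beta> exps(3) D D_bound x] x by simp
    have "D x = 0" if x: "x \<in> {0<..T}" for x
    proof -
      have "((\<lambda>_. 0) has_real_derivative D x) (at x within {0<..T})"
        by (rule has_field_derivative_transform_within[OF RL_1_has_real_derivative[OF exps(3) D D_bound x]
              zero_less_one x J1D])
      from has_real_derivative_imp_vector_derivative_Ioc[OF this x]
        has_real_derivative_imp_vector_derivative_Ioc[OF DERIV_const x]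
      show ?thesis by metis
    qed
    then show "continuous_on {0..T} u \<and> u 0 = u0 \<and>
        (\<forall>x\<in>{0<..T}. u x = RL_integral \<beta> g x + K_op \<beta> u x)"
      using u sol RL_h by (auto simp: D_def censored_ivp_solution_def)
  next
    assume fp: "continuous_on {0..T} u \<and> u 0 = u0 \<and>
        (\<forall>x\<in>{0<..T}. u x = RL_integral \<beta> g x + K_op \<beta> u x)"
    have J1h: "RL_integral (1 - \<beta>) u x = RL_integral 1 h x" if x: "x \<in> {0<..T}" for x
    proof -
      have "RL_integral (1 - \<beta>) u x = RL_integral (1 - \<beta>) (RL_integral \<beta> h) x"
        using x fp RL_h by (intro RL_cong) auto
      then show ?thesis using JJh[OF x] by simp
    qed
    have deriv: "(RL_integral (1 - \<beta>) u has_real_derivative h x) (at x within {0<..T})"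
      if x: "x \<in> {0<..T}" for x
      by (rule has_field_derivative_transform_within[OF D_J1h[OF x] zero_less_one x J1h[symmetric]])
    have "set_integrable lborel {0<..T} u"
      by (rule set_integrable_subset[OF borel_integrable_atLeastAtMost'[OF u]]) auto
    moreover have "RL_integral (1 - \<beta>) u \<in> C1_half_open T"
      unfolding C1_half_open_def using h deriv by blast
    ultimately have "u \<in> C_beta_closed \<beta> T"
      using u u' by (simp add: C_beta_closed_def C_beta_half_open_def cont_L1_def)
    moreover have "censored_deriv \<beta> T u x = g x" if x: "x \<in> {0<..T}" for x
      unfolding censored_deriv_def RL_deriv_def
        has_real_derivative_imp_vector_derivative_Ioc[OF deriv[OF x] x]
      by (simp add: h_def)
    ultimately show "censored_ivp_solution \<beta> T g u0 u"
      using fp by (simp add: censored_ivp_solution_def)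
  qed
qed

section \<open>Convergence of the series\<close>

text \<open>J^\<beta> g is of order x^\<alpha> since \<beta> + (\<alpha> - \<beta>) = \<alpha>, and
  each K contributes a factor c(\<alpha>). Continuity and growth are carried through one induction
  because the estimates for K need both.\<close>

lemma censored_series_term_properties:
  shows "continuous_on {0<..T} (\<lambda>x. censored_series_term \<beta> g x j)"
    and "\<And>x. x \<in> {0<..T} \<Longrightarrow> \<bar>censored_series_term \<beta> g x j\<bar>
           \<le> (M * RL_moment \<beta> (\<alpha> - \<beta>) * K_moment \<beta> \<alpha> ^ j) * x powr \<alpha>"
    and "censored_series_term \<beta> g 0 j = 0"
proof -
  define A where "A = M * RL_moment \<beta> (\<alpha> - \<beta>)"
  have exp: "-1 < \<alpha> - \<beta>" using \<alpha> \<beta> by simp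
  have "continuous_on {0<..T} ((K_op \<beta> ^^ j) (RL_integral \<beta> g)) \<and>
      (\<forall>x\<in>{0<..T}. \<bar>(K_op \<beta> ^^ j) (RL_integral \<beta> g) x\<bar> \<le> (A * K_moment \<beta> \<alpha> ^ j) * x powr \<alpha>) \<and>
      (K_op \<beta> ^^ j) (RL_integral \<beta> g) 0 = 0"
  proof (induction j)
    case 0
    show ?case
      using RL_continuous[OF \<beta>(1) exp g g_bound] RL_bound[OF \<beta>(1) exp g g_bound]
      by (simp add: A_def RL_0)
  next
    case (Suc j)
    note K = K_op_continuous[OF \<beta> less_imp_le[OF \<alpha>], of T "(K_op \<beta> ^^ j) (RL_integral \<beta> g)" "A * K_moment \<beta> \<alpha> ^ j"]
      K_op_bound[OF \<beta> less_imp_le[OF \<alpha>], of T "(K_op \<beta> ^^ j) (RL_integral \<beta> g)" "A * K_moment \<beta> \<alpha> ^ j"]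
    show ?case
      using K Suc by (auto simp: K_op_def[of \<beta> _ 0] mult_ac)
  qed
  then show "continuous_on {0<..T} (\<lambda>x. censored_series_term \<beta> g x j)"
    and "\<And>x. x \<in> {0<..T} \<Longrightarrow> \<bar>censored_series_term \<beta> g x j\<bar>
           \<le> (M * RL_moment \<beta> (\<alpha> - \<beta>) * K_moment \<beta> \<alpha> ^ j) * x powr \<alpha>"
    and "censored_series_term \<beta> g 0 j = 0"
    unfolding censored_series_term_def A_def by auto
qed

text \<open>All facts rest on the majorant A c^j x^\<alpha> with c = c(\<alpha>) < 1. The fixed
  point property comes from interchanging K with the sum and shifting the index.\<close>

lemma
  shows summable_abs_censored_series:
      "x \<in> {0..T} \<Longrightarrow> summable (\<lambda>j. \<bar>censored_series_term \<beta> g x j\<bar>)"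
    and censored_integral_bound: "x \<in> {0<..T} \<Longrightarrow> \<bar>censored_integral \<beta> g x\<bar>
      \<le> M * RL_moment \<beta> (\<alpha> - \<beta>) / (1 - K_moment \<beta> \<alpha>) * x powr \<alpha>"
    and censored_integral_0: "censored_integral \<beta> g 0 = 0"
    and censored_integral_continuous: "continuous_on {0..T} (censored_integral \<beta> g)"
    and censored_integral_fixpoint: "x \<in> {0<..T} \<Longrightarrow>
      censored_integral \<beta> g x = RL_integral \<beta> g x + K_op \<beta> (censored_integral \<beta> g) x"
proof -
  define A where "A = M * RL_moment \<beta> (\<alpha> - \<beta>)"
  define c where "c = K_moment \<beta> \<alpha>"
  have c: "0 \<le> c" "c < 1"
    using K_moment_nonneg[OF \<beta>] K_moment_less_1[OF \<beta> \<alpha>] by (auto simp: c_def)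
  note terms = censored_series_term_properties[folded A_def c_def]
  \<comment> \<open>The free factor y is later x^\<alpha>, or c x^\<alpha> after one more
    application of K.\<close>
  have geom: "(\<lambda>j. A * c ^ j * y) sums (A / (1 - c) * y)" for y
    using sums_mult2[OF sums_mult[OF geometric_sums[of c], of A], of y] c by simp
  have summable: "summable (\<lambda>j. \<bar>censored_series_term \<beta> g x j\<bar>)" if "x \<in> {0..T}" for x
  proof (cases "x = 0")
    case False
    then show ?thesis
      using that terms(2)[of x] by (intro summable_comparison_test'[OF sums_summable[OF geom]]) auto
  qed (simp add: terms(3))
  then show "x \<in> {0..T} \<Longrightarrow> summable (\<lambda>j. \<bar>censored_series_term \<beta> g x j\<bar>)" .
  have bound: "\<bar>censored_integral \<beta> g x\<bar> \<le> A / (1 - c) * x powr \<alpha>" if x: "x \<in> {0<..T}" for x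
  proof -
    have sm: "summable (\<lambda>j. \<bar>censored_series_term \<beta> g x j\<bar>)" using summable x by auto
    have "\<bar>censored_integral \<beta> g x\<bar> \<le> (\<Sum>j. \<bar>censored_series_term \<beta> g x j\<bar>)"
      unfolding censored_integral_def by (rule summable_rabs[OF sm])
    also have "\<dots> \<le> (\<Sum>j. A * c ^ j * x powr \<alpha>)"
      by (intro suminf_le sm sums_summable[OF geom] terms(2) x)
    finally show ?thesis using sums_unique[OF geom] by simp
  qed
  then show "x \<in> {0<..T} \<Longrightarrow> \<bar>censored_integral \<beta> g x\<bar>
      \<le> M * RL_moment \<beta> (\<alpha> - \<beta>) / (1 - K_moment \<beta> \<alpha>) * x powr \<alpha>"
    by (simp add: A_def c_def)
  show zero: "censored_integral \<beta> g 0 = 0" by (simp add: censored_integral_def terms(3))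
  \<comment> \<open>Weierstrass test with the x-free majorant \<bar>A\<bar> c^j T^\<alpha>.\<close>
  have cont: "continuous_on {0<..T} (censored_integral \<beta> g)"
    unfolding censored_integral_def
  proof (rule uniform_limit_theorem[OF _ Weierstrass_m_test])
    show "\<forall>\<^sub>F n in sequentially. continuous_on {0<..T} (\<lambda>x. \<Sum>i<n. censored_series_term \<beta> g x i)"
      by (intro always_eventually allI continuous_intros terms(1))
    show "summable (\<lambda>j. \<bar>A\<bar> * (c ^ j * T powr \<alpha>))"
      using c by (intro summable_mult summable_mult2 summable_geometric) auto
    fix n x assume x: "x \<in> {0<..T}"
    have "A * c ^ n * x powr \<alpha> \<le> \<bar>A\<bar> * (c ^ n * T powr \<alpha>)"
      using x \<alpha> c unfolding mult.assoc by (intro mult_mono mult_left_mono powr_mono2) auto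
    then show "norm (censored_series_term \<beta> g x n) \<le> \<bar>A\<bar> * (c ^ n * T powr \<alpha>)"
      using terms(2)[OF x, of n] by simp
  qed auto
  show "continuous_on {0..T} (censored_integral \<beta> g)"
    by (rule continuous_on_Icc_of_power_bound[OF cont \<alpha> bound zero])
  show "censored_integral \<beta> g x = RL_integral \<beta> g x + K_op \<beta> (censored_integral \<beta> g) x"
    if x: "x \<in> {0<..T}"
  proof -
    define F where "F = (\<lambda>j s. indicator {0<..<1} s *\<^sub>R (K_weight \<beta> s * censored_series_term \<beta> g (x * s) j))"
    have F_int: "integrable lborel (F j)" for j
      using K_integrable[OF \<beta> less_imp_le[OF \<alpha>] terms(1) terms(2) x] by (simp add: F_def set_integrable_def)
    \<comment> \<open>Interchange of sum and integral, justified by summability of the L1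
      norms.\<close>
    have "(\<lambda>j. \<integral>s. F j s \<partial>lborel) sums (\<integral>s. (\<Sum>j. F j s) \<partial>lborel)"
    proof (rule sums_integral[OF F_int])
      have "summable (\<lambda>j. norm (F j s))" for s
      proof (cases "s \<in> {0<..<1}")
        case True
        then show ?thesis
          using summable[of "x * s"] mult_unit_mem_Ioc[OF x True]
          by (auto simp: F_def abs_mult intro!: summable_mult)
      qed (simp add: F_def)
      then show "AE s in lborel. summable (\<lambda>j. norm (F j s))" by simp
      show "summable (\<lambda>j. \<integral>s. norm (F j s) \<partial>lborel)"
      proof (rule summable_comparison_test'[OF sums_summable[OF geom[of "c * x powr \<alpha>"]]])
        fix j :: nat
        \<comment> \<open>As the density is positive, the L1 norm is K applied to the absolute value
          of the j-th term, so \<open>K_op_bound\<close> yields A c^(j+1) x^\<alpha>.\<close>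
        have "(\<integral>s. norm (F j s) \<partial>lborel) = K_op \<beta> (\<lambda>r. \<bar>censored_series_term \<beta> g r j\<bar>) x"
          using x unfolding F_def
          by (auto simp: K_op_eq_scaled_mean[OF \<beta>] scaled_mean_def set_lebesgue_integral_def abs_mult
              indicator_def K_weight_pos[OF \<beta>] less_imp_le intro!: Bochner_Integration.integral_cong)
        then show "norm (\<integral>s. norm (F j s) \<partial>lborel) \<le> A * c ^ j * (c * x powr \<alpha>)"
          using K_op_bound[OF \<beta> less_imp_le[OF \<alpha>], of T "\<lambda>r. \<bar>censored_series_term \<beta> g r j\<bar>" "A * c ^ j" x]
            x terms(1)[of j] terms(2)[of _ j]
          by (simp add: continuous_on_rabs c_def[symmetric] mult_ac)
      qed
    qed
    moreover have "(\<integral>s. F j s \<partial>lborel) = censored_series_term \<beta> g x (Suc j)" for j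
      using x unfolding F_def
      by (simp add: K_op_eq_scaled_mean[OF \<beta>] scaled_mean_def set_lebesgue_integral_def censored_series_term_def)
    moreover have "(\<integral>s. (\<Sum>j. F j s) \<partial>lborel) = K_op \<beta> (censored_integral \<beta> g) x"
    proof -
      have "(\<Sum>j. F j s) = indicator {0<..<1} s *\<^sub>R (K_weight \<beta> s * censored_integral \<beta> g (x * s))" for s
      proof (cases "s \<in> {0<..<1}")
        case True
        then have "summable (censored_series_term \<beta> g (x * s))"
          using summable[of "x * s"] mult_unit_mem_Ioc[OF x True] by (auto intro: summable_rabs_cancel)
        then show ?thesis using True by (simp add: F_def censored_integral_def suminf_mult)
      qed (simp add: F_def)
      then show ?thesis
        using x by (simp add: K_op_eq_scaled_mean[OF \<beta>] scaled_mean_def set_lebesgue_integral_def)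
    qed
    ultimately have "(\<lambda>j. censored_series_term \<beta> g x (Suc j)) sums K_op \<beta> (censored_integral \<beta> g) x"
      by simp
    \<comment> \<open>K turns term j into term j + 1; the missing term 0 is J^\<beta> g.\<close>
    then have "censored_series_term \<beta> g x sums
        (K_op \<beta> (censored_integral \<beta> g) x + censored_series_term \<beta> g x 0)"
      by (rule sums_Suc)
    then show ?thesis
      by (simp add: censored_integral_def[of _ _ x] sums_iff censored_series_term_def[of _ _ _ 0])
  qed
qed

section \<open>Existence, uniqueness and stability\<close>

lemma K_op_shift:
  assumes "continuous_on {0..T} u" "x \<in> {0<..T}"
  shows "K_op \<beta> (\<lambda>r. u r - a) x = K_op \<beta> u x - a"
proof -
  obtain m where m: "\<And>x. x \<in> {0..T} \<Longrightarrow> \<bar>u x\<bar> \<le> m"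
    using continuous_on_Icc_bounded[OF assms(1)] by blast
  have "K_op \<beta> (\<lambda>r. u r - a) x = K_op \<beta> u x - K_op \<beta> (\<lambda>_. a) x"
    by (rule K_op_diff[OF \<beta> assms(2), of u m "\<lambda>_. a" "\<bar>a\<bar>"])
       (use m in \<open>auto intro: continuous_on_subset[OF assms(1)]\<close>)
  then show ?thesis using K_op_const[OF \<beta>] assms(2) by simp
qed

text \<open>Since K fixes constants, u0 cancels in the fixed point equation, and the case of initial
  value 0 is enough.\<close>

lemma censored_ivp_solution_exists:
  "censored_ivp_solution \<beta> T g u0 (\<lambda>x. u0 + censored_integral \<beta> g x)"
proof -
  define u where "u = (\<lambda>x. u0 + censored_integral \<beta> g x)"
  have u: "continuous_on {0..T} u"
    unfolding u_def by (intro continuous_intros censored_integral_continuous)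
  have "u x = RL_integral \<beta> g x + K_op \<beta> u x" if x: "x \<in> {0<..T}" for x
    using K_op_shift[OF u x, of u0] censored_integral_fixpoint[OF x] by (simp add: u_def)
  then show ?thesis
    using u censored_integral_0
    by (simp add: censored_ivp_solution_iff_fixpoint u_def[symmetric]) (simp add: u_def)
qed

text \<open>In the difference of two fixed points J^\<beta> g cancels, leaving a fixed point of K
  that vanishes at 0.\<close>

lemma censored_ivp_solution_unique:
  assumes sol: "censored_ivp_solution \<beta> T g u0 v" and x: "x \<in> {0..T}"
  shows "v x = u0 + censored_integral \<beta> g x"
proof -
  define u where "u = (\<lambda>x. u0 + censored_integral \<beta> g x)"
  have sol_u: "censored_ivp_solution \<beta> T g u0 u"
    unfolding u_def by (rule censored_ivp_solution_exists)
  have u: "continuous_on {0..T} u" "u 0 = u0"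
      "\<And>x. x \<in> {0<..T} \<Longrightarrow> u x = RL_integral \<beta> g x + K_op \<beta> u x"
    and v: "continuous_on {0..T} v" "v 0 = u0"
      "\<And>x. x \<in> {0<..T} \<Longrightarrow> v x = RL_integral \<beta> g x + K_op \<beta> v x"
    using sol sol_u unfolding censored_ivp_solution_iff_fixpoint by auto
  obtain m n where mn: "\<And>x. x \<in> {0..T} \<Longrightarrow> \<bar>u x\<bar> \<le> m" "\<And>x. x \<in> {0..T} \<Longrightarrow> \<bar>v x\<bar> \<le> n"
    using continuous_on_Icc_bounded[OF u(1)] continuous_on_Icc_bounded[OF v(1)] by metis
  have "v x - u x = 0"
  proof (rule K_op_fixpoint_eq_0[OF \<beta> T _ _ _ x])
    show "continuous_on {0..T} (\<lambda>x. v x - u x)" by (intro continuous_intros u v)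
    fix y assume y: "y \<in> {0<..T}"
    have "K_op \<beta> (\<lambda>r. v r - u r) y = K_op \<beta> v y - K_op \<beta> u y"
      by (rule K_op_diff[OF \<beta> y, of v n u m])
         (use mn in \<open>auto intro: continuous_on_subset[OF v(1)] continuous_on_subset[OF u(1)]\<close>)
    then show "v y - u y = K_op \<beta> (\<lambda>r. v r - u r) y" using u(3)[OF y] v(3)[OF y] by simp
  qed (simp add: u v)
  then show ?thesis by (simp add: u_def)
qed

text \<open>Uniqueness identifies v with the series, whose bound is linear in M. The factor of M
  depends on \<alpha>, \<beta> and T alone.\<close>

lemma censored_ivp_solution_stable:
  assumes sol: "censored_ivp_solution \<beta> T g u0 v" and M: "0 \<le> M"
  shows "sup_norm T (\<lambda>x. v x - u0) \<le> RL_moment \<beta> (\<alpha> - \<beta>) / (1 - K_moment \<beta> \<alpha>) * T powr \<alpha> * M"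
  unfolding sup_norm_def
proof (rule cSUP_least)
  define B where "B = RL_moment \<beta> (\<alpha> - \<beta>) / (1 - K_moment \<beta> \<alpha>)"
  have "0 \<le> B"
    using RL_moment_nonneg[OF \<beta>(1)] K_moment_less_1[OF \<beta> \<alpha>] by (simp add: B_def)
  fix x assume x: "x \<in> {0..T}"
  have "\<bar>censored_integral \<beta> g x\<bar> \<le> B * T powr \<alpha> * M"
  proof (cases "x = 0")
    case True
    then show ?thesis using censored_integral_0 \<open>0 \<le> B\<close> M by simp
  next
    case False
    then have "\<bar>censored_integral \<beta> g x\<bar> \<le> M * B * x powr \<alpha>"
      using censored_integral_bound[of x] x by (simp add: B_def)
    also have "\<dots> \<le> M * B * T powr \<alpha>"
      using x \<alpha> M \<open>0 \<le> B\<close> by (intro mult_left_mono powr_mono2) auto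
    finally show ?thesis by (simp add: mult_ac)
  qed
  then show "\<bar>v x - u0\<bar> \<le> RL_moment \<beta> (\<alpha> - \<beta>) / (1 - K_moment \<beta> \<alpha>) * T powr \<alpha> * M"
    using censored_ivp_solution_unique[OF sol x] by (simp add: B_def)
qed (use T in auto)

end

end

section \<open>Assembly of well-posedness and the two norm estimates\<close>

theorem theorem3p2:
  fixes \<beta> T :: real
  assumes "0 < \<beta>" and "\<beta> < 1" and "0 < T"
  shows
    "(\<forall>(u\<^sub>0::real) (g::real \<Rightarrow> real) (M::real) (\<alpha>::real).
        0 < M \<longrightarrow> 0 < \<alpha> \<longrightarrow> admissible_source \<beta> T \<alpha> M g \<longrightarrow>
        (\<exists>u::real \<Rightarrow> real.
            censored_ivp_solution \<beta> T g u\<^sub>0 u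
          \<and> (\<forall>v. censored_ivp_solution \<beta> T g u\<^sub>0 v \<longrightarrow> (\<forall>x\<in>{0..T}. v x = u x))
          \<and> (\<forall>x\<in>{0..T}. summable (censored_series_term \<beta> g x)
                       \<and> u x - u\<^sub>0 = censored_integral \<beta> g x)))
   \<and> (\<forall>\<alpha>::real. 0 < \<alpha> \<longrightarrow>
        (\<exists>C::real. \<forall>(u\<^sub>0::real) (g::real \<Rightarrow> real) (M::real) (u::real \<Rightarrow> real).
            0 < M \<longrightarrow> admissible_source \<beta> T \<alpha> M g \<longrightarrow> censored_ivp_solution \<beta> T g u\<^sub>0 u \<longrightarrow>
            sup_norm T (\<lambda>x. u x - u\<^sub>0) \<le> C * (SUP x\<in>{0<..T}. \<bar>x powr (\<beta> - \<alpha>) * g x\<bar>)))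
   \<and> (\<exists>C::real. \<forall>(u\<^sub>0::real) (g::real \<Rightarrow> real) (u::real \<Rightarrow> real).
            continuous_on {0..T} g \<longrightarrow> censored_ivp_solution \<beta> T g u\<^sub>0 u \<longrightarrow>
            sup_norm T (\<lambda>x. u x - u\<^sub>0) \<le> C * sup_norm T g)"
proof (intro conjI allI impI)
  fix u0 :: real and g :: "real \<Rightarrow> real" and M \<alpha> :: real
  assume \<alpha>: "0 < \<alpha>" and adm: "admissible_source \<beta> T \<alpha> M g"
  have g: "continuous_on {0<..T} g" "\<And>r. r \<in> {0<..T} \<Longrightarrow> \<bar>g r\<bar> \<le> M * r powr (\<alpha> - \<beta>)"
    using adm by (auto simp: admissible_source_def)
  show "\<exists>u. censored_ivp_solution \<beta> T g u0 u
          \<and> (\<forall>v. censored_ivp_solution \<beta> T g u0 v \<longrightarrow> (\<forall>x\<in>{0..T}. v x = u x))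
          \<and> (\<forall>x\<in>{0..T}. summable (censored_series_term \<beta> g x) \<and> u x - u0 = censored_integral \<beta> g x)"
  proof (intro exI conjI ballI allI impI)
    show "censored_ivp_solution \<beta> T g u0 (\<lambda>x. u0 + censored_integral \<beta> g x)"
      by (rule censored_ivp_solution_exists[OF assms \<alpha> g])
    show "v x = u0 + censored_integral \<beta> g x"
      if "censored_ivp_solution \<beta> T g u0 v" "x \<in> {0..T}" for v x
      by (rule censored_ivp_solution_unique[OF assms \<alpha> g that])
    show "summable (censored_series_term \<beta> g x)" if "x \<in> {0..T}" for x
      by (rule summable_rabs_cancel[OF summable_abs_censored_series[OF assms \<alpha> g that]])
  qed simp
next
  fix \<alpha> :: real
  assume \<alpha>: "0 < \<alpha>"
  define C where "C = RL_moment \<beta> (\<alpha> - \<beta>) / (1 - K_moment \<beta> \<alpha>) * T powr \<alpha>"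
  show "\<exists>C. \<forall>u0 g M u. 0 < M \<longrightarrow> admissible_source \<beta> T \<alpha> M g \<longrightarrow>
      censored_ivp_solution \<beta> T g u0 u \<longrightarrow>
      sup_norm T (\<lambda>x. u x - u0) \<le> C * (SUP x\<in>{0<..T}. \<bar>x powr (\<beta> - \<alpha>) * g x\<bar>)"
  proof (intro exI[of _ C] allI impI)
    fix u0 :: real and g :: "real \<Rightarrow> real" and M :: real and u :: "real \<Rightarrow> real"
    assume adm: "admissible_source \<beta> T \<alpha> M g" and sol: "censored_ivp_solution \<beta> T g u0 u"
    \<comment> \<open>The least constant admissible in the growth bound; M only shows that the
      supremum is taken over a bounded set. Stability is then applied with \<open>S\<close> in place
      of M.\<close>
    define S where "S = (SUP x\<in>{0<..T}. \<bar>x powr (\<beta> - \<alpha>) * g x\<bar>)"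
    have g_eq: "\<bar>g x\<bar> = \<bar>x powr (\<beta> - \<alpha>) * g x\<bar> * x powr (\<alpha> - \<beta>)" if "x \<in> {0<..T}" for x
      using that powr_add[of x "\<beta> - \<alpha>" "\<alpha> - \<beta>"] by (simp add: abs_mult mult_ac)
    have "\<bar>x powr (\<beta> - \<alpha>) * g x\<bar> \<le> M" if x: "x \<in> {0<..T}" for x
    proof -
      have "\<bar>x powr (\<beta> - \<alpha>) * g x\<bar> * x powr (\<alpha> - \<beta>) \<le> M * x powr (\<alpha> - \<beta>)"
        using adm x unfolding admissible_source_def g_eq[OF x, symmetric] by blast
      then show ?thesis using x by (subst (asm) mult_le_cancel_right_pos) auto
    qed
    then have S_upper: "\<bar>x powr (\<beta> - \<alpha>) * g x\<bar> \<le> S" if "x \<in> {0<..T}" for x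
      unfolding S_def using that by (intro cSUP_upper bdd_aboveI2[of _ _ M]) auto
    \<comment> \<open>The point T witnesses that the supremum is over a nonempty set of nonnegative
      numbers.\<close>
    have "0 \<le> S" using order_trans[OF abs_ge_zero S_upper[of T]] assms by simp
    have g_bound: "\<bar>g x\<bar> \<le> S * x powr (\<alpha> - \<beta>)" if "x \<in> {0<..T}" for x
      unfolding g_eq[OF that] by (intro mult_right_mono S_upper that) auto
    have g: "continuous_on {0<..T} g" using adm by (simp add: admissible_source_def)
    show "sup_norm T (\<lambda>x. u x - u0) \<le> C * (SUP x\<in>{0<..T}. \<bar>x powr (\<beta> - \<alpha>) * g x\<bar>)"
      using censored_ivp_solution_stable[OF assms \<alpha> g g_bound sol \<open>0 \<le> S\<close>]
      by (simp add: C_def S_def)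
  qed
next
  \<comment> \<open>The case \<alpha> = \<beta>: the weight x^(\<alpha> - \<beta>) is 1 on (0, T],
    so the sup norm of g serves as M, and the constant depends on \<beta> and T only.\<close>
  define C where "C = RL_moment \<beta> (\<beta> - \<beta>) / (1 - K_moment \<beta> \<beta>) * T powr \<beta>"
  show "\<exists>C. \<forall>u0 g u. continuous_on {0..T} g \<longrightarrow> censored_ivp_solution \<beta> T g u0 u \<longrightarrow>
      sup_norm T (\<lambda>x. u x - u0) \<le> C * sup_norm T g"
  proof (intro exI[of _ C] allI impI)
    fix u0 :: real and g u :: "real \<Rightarrow> real"
    assume g: "continuous_on {0..T} g" and sol: "censored_ivp_solution \<beta> T g u0 u"
    obtain m where m: "\<And>x. x \<in> {0..T} \<Longrightarrow> \<bar>g x\<bar> \<le> m"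
      using continuous_on_Icc_bounded[OF g] by blast
    then have le: "\<bar>g x\<bar> \<le> sup_norm T g" if "x \<in> {0..T}" for x
      unfolding sup_norm_def using that by (intro cSUP_upper bdd_aboveI2[of _ _ m]) auto
    have "0 \<le> sup_norm T g" using order_trans[OF abs_ge_zero le[of T]] assms by simp
    have g': "continuous_on {0<..T} g" by (rule continuous_on_subset[OF g]) auto
    have g_bound: "\<bar>g x\<bar> \<le> sup_norm T g * x powr (\<beta> - \<beta>)" if "x \<in> {0<..T}" for x
      using le[of x] that by simp
    show "sup_norm T (\<lambda>x. u x - u0) \<le> C * sup_norm T g"
      using censored_ivp_solution_stable[OF assms assms(1) g' g_bound sol \<open>0 \<le> sup_norm T g\<close>]
      by (simp add: C_def)
  qed
qed

end
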